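(* Let $G$ be a Hausdorff topological group. The following are equivalent. (1) $G$ is amenable. (2) For every $\theta \in (0,1)$, every finite subset $E \subseteq G$, and every $U \in \mathcal{U}_{e}(G)$, there exists a finite non-empty subset $F \subseteq G$ such that $\mu(F,gF,U) \geq \theta |F|$ for all $g \in E$. (3) There exists $\theta \in (0,1)$ such that, for every finite subset $E \subseteq G$ and every $U \in \mathcal{U}_{e}(G)$, there exists a finite non-empty subset $F \subseteq G$ such that $\mu(F,gF,U) \geq \theta |F|$ for all $g \in E$.
   Context: $\mathcal{U}_{e}(G)$ denotes the neighborhood filter of the neutral element $e$ of $G$. Amenability: for $g \in G$ let $\lambda_{g}(x) = gx$. $\mathrm{RUC}_{b}(G)$ is the space of bounded real-valued functions on $G$ that are uniformly continuous with respect to the right uniformity (whose entourages are the sets containing $\{(x,y) \mid xy^{-1} \in U\}$ for some $U \in \mathcal{U}_{e}(G)$). $G$ is amenable if there is a positive linear map $m \colon \mathrm{RUC}_{b}(G) \to \mathbb{R}$ with $m(\mathbf{1}) = 1$ and $m(f \circ \lambda_{g}) = m(f)$ for all $f \in \mathrm{RUC}_{b}(G)$, $g \in G$. Matching number: for finite subsets $E,F \subseteq G$ and $U \in \mathcal{U}_{e}(G)$, $\mu(E,F,U)$ is the maximum of $|D|$ over all injective maps $\phi \colon D \to F$ with $D \subseteq E$ and $\phi(x)x^{-1} \in U$ for all $x \in D$ (i.e. the matching number of the bipartite graph on $E$ and $F$ with edge relation $\{(x,y) \in E \times F \mid yx^{-1} \in U\}$). *)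

theory Defs
  imports "HOL-Analysis.Analysis"
begin

text \<open>
  Topological groups are rendered by the class \<^class>\<open>topological_group_add\<close>, which rests on
  \<^class>\<open>group_add\<close> and hence does not assume commutativity; only the notation is additive.
  Thus the neutral element is \<open>0\<close>, the product \<open>g x\<close> is \<open>g + x\<close>, and \<open>x y\<^sup>-\<^sup>1\<close> is
  \<open>x - y\<close>, i.e. \<open>x + (- y)\<close> in this order.
\<close>

definition nbhds_neutral :: "'a::topological_group_add set set"
  where "nbhds_neutral = {U. eventually (\<lambda>x. x \<in> U) (nhds 0)}"

text \<open>
  The entourages of the right uniformity are the sets containing
  \<open>{(x, y). x - y \<in> U}\<close> for some neighbourhood \<open>U\<close> of the neutral element. The class
  \<^class>\<open>uniform_space\<close> is not used since it would fix one uniformity on the type, and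
  \<^class>\<open>uniform_topological_group_add\<close> would force the left and right ones to agree.
\<close>

definition right_uniformity :: "('a::topological_group_add \<times> 'a) filter"
  where "right_uniformity = filtercomap (\<lambda>(x, y). x - y) (nhds 0)"

lemma eventually_right_uniformity_iff:
  "eventually (\<lambda>p. p \<in> V) (right_uniformity :: ('a::topological_group_add \<times> 'a) filter)
    \<longleftrightarrow> (\<exists>U\<in>nbhds_neutral. {(x, y). x - y \<in> U} \<subseteq> V)"
proof
  assume "eventually (\<lambda>p. p \<in> V) (right_uniformity :: ('a \<times> 'a) filter)"
  then obtain Q where "eventually Q (nhds (0::'a))" "\<And>x y. Q (x - y) \<Longrightarrow> (x, y) \<in> V"
    unfolding right_uniformity_def eventually_filtercomap by fastforce
  then show "\<exists>U\<in>nbhds_neutral. {(x, y). x - y \<in> U} \<subseteq> V"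
    by (intro bexI[of _ "Collect Q"]) (auto simp: nbhds_neutral_def)
next
  assume "\<exists>U\<in>nbhds_neutral. {(x, y). x - y \<in> U} \<subseteq> V"
  then show "eventually (\<lambda>p. p \<in> V) (right_uniformity :: ('a \<times> 'a) filter)"
    unfolding right_uniformity_def eventually_filtercomap nbhds_neutral_def by fastforce
qed

definition RUC_b :: "('a::topological_group_add \<Rightarrow> real) set"
  where "RUC_b = {f. bounded (range f) \<and>
    filterlim (\<lambda>(x, y). (f x, f y)) uniformity right_uniformity}"

text \<open>
  The functional \<open>m\<close> is a total function in HOL, but it is constrained on \<^const>\<open>RUC_b\<close> only.
\<close>

definition amenable :: "'a::topological_group_add itself \<Rightarrow> bool"
  where "amenable (_ :: 'a itself) \<longleftrightarrow>
    (\<exists>m :: ('a \<Rightarrow> real) \<Rightarrow> real.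
      (\<forall>f\<in>RUC_b. \<forall>h\<in>RUC_b. m (\<lambda>x. f x + h x) = m f + m h) \<and>
      (\<forall>c. \<forall>f\<in>RUC_b. m (\<lambda>x. c * f x) = c * m f) \<and>
      (\<forall>f\<in>RUC_b. (\<forall>x. 0 \<le> f x) \<longrightarrow> 0 \<le> m f) \<and>
      m (\<lambda>_. 1) = 1 \<and>
      (\<forall>f\<in>RUC_b. \<forall>g. m (f \<circ> (\<lambda>x. g + x)) = m f))"

text \<open>
  For finite \<open>E\<close> this is a maximum over a finite non-empty set; no meaning is intended
  otherwise.
\<close>

definition matching_number :: "'a::topological_group_add set \<Rightarrow> 'a set \<Rightarrow> 'a set \<Rightarrow> nat"
  where "matching_number E F U =
    Max {card D | D \<phi>. D \<subseteq> E \<and> inj_on \<phi> D \<and> \<phi> ` D \<subseteq> F \<and> (\<forall>x\<in>D. \<phi> x - x \<in> U)}"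

lemma matching_number_ge_iff:
  assumes "finite E"
  shows "n \<le> matching_number E F U \<longleftrightarrow>
    (\<exists>D \<phi>. D \<subseteq> E \<and> inj_on \<phi> D \<and> \<phi> ` D \<subseteq> F \<and> (\<forall>x\<in>D. \<phi> x - x \<in> U) \<and> n \<le> card D)"
proof -
  let ?S = "{card D | D \<phi>. D \<subseteq> E \<and> inj_on \<phi> D \<and> \<phi> ` D \<subseteq> F \<and> (\<forall>x\<in>D. \<phi> x - x \<in> U)}"
  have "?S \<subseteq> {..card E}"
    using assms by (auto intro: card_mono)
  then have "finite ?S"
    by (rule finite_subset) simp
  moreover have "?S \<noteq> {}"
    by (force intro: exI[of _ "{}"])
  ultimately have "n \<le> Max ?S \<longleftrightarrow> (\<exists>k\<in>?S. n \<le> k)"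
    by (rule Max_ge_iff)
  then show ?thesis
    unfolding matching_number_def by auto
qed

end

theory Submission
  imports Defs
begin

text \<open>
  From matchings to amenability. The uniform measures on the sets \<open>F\<close> have a weak-* limit \<open>m\<close>, a
  mean whose Hellinger affinity with each of its translates is at least \<open>\<theta>\<close>. Among all means choose
  one, \<open>\<nu>\<close>, for which the infimum of the affinities with the translates of \<open>m\<close> is maximal. A
  translate of \<open>\<nu>\<close> is maximal as well, and if it differed from \<open>\<nu>\<close>, the square of the midpoint of
  their square roots would have mass less than 1 but no smaller affinities, so that normalizing it
  would contradict maximality. Hence \<open>\<nu>\<close> is invariant.

  From amenability to matchings. For a continuous pseudonorm \<open>\<rho>\<close> adapted to \<open>U\<close>, a minimax argument
  gives a finite set \<open>F\<close> whose uniform measure is almost invariant simultaneously for all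
  \<open>[0, 1]\<close>-valued functions that are 1-Lipschitz for \<open>\<rho>\<close>. Applied to the functions
  \<open>max 0 (1 - dist(_, J))\<close> for \<open>J \<subseteq> F\<close>, this is Hall's condition with defect \<open>(1 - \<theta>) |F|\<close>.
\<close>

section \<open>Right uniformly continuous functions\<close>

text \<open>A small \<open>\<theta>\<close> gives no almost invariance of \<open>m\<close>, only a
  uniform overlap with its translates, and averaging over the group is precisely what is not yet
  available; hence an extremal argument. A finitely additive mean has no square root at hand, so the
  affinity is handled only through its variational formula. As an infimum of affine weak-*
  continuous functionals of \<open>\<nu>\<close>, indexed by test functions \<open>a\<close> bounded
  away from 0, it is upper semicontinuous, so that a maximizer exists. A matching bounds it from
  below because \<open>a x + 1 / a x \<ge> 2\<close>. Taking the infimum over the whole orbit of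
  \<open>m\<close> makes the set of maximizers invariant under translation.

  In the converse, the sets \<open>J\<close> of Hall's condition depend on \<open>F\<close>, so
  \<open>F\<close> has to serve a whole class of functions fixed before it. Moreover, minimax yields
  a weighted measure, while matchings need a set: the weights are rounded to multiplicities, and the
  multiplicities have to be removed afterwards.\<close>

lemma RUC_b_iff:
  "f \<in> RUC_b \<longleftrightarrow> (\<exists>B. \<forall>x. \<bar>f x\<bar> \<le> B) \<and>
    (\<forall>e>0. \<forall>\<^sub>F v in nhds 0. \<forall>x. \<bar>f (v + x) - f x\<bar> < e)"
proof -
  have "filterlim (\<lambda>(x, y). (f x, f y)) uniformity right_uniformity \<longleftrightarrow>
      (\<forall>e>0. \<forall>\<^sub>F v in nhds 0. \<forall>x. \<bar>f (v + x) - f x\<bar> < e)" (is "?L \<longleftrightarrow> ?R")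
  proof
    assume L: ?L
    show ?R
    proof (intro allI impI)
      fix e :: real assume "e > 0"
      then have "eventually (\<lambda>(a, b). dist a b < e) (uniformity :: (real \<times> real) filter)"
        by (auto simp: eventually_uniformity_metric)
      with L have "eventually (\<lambda>(x, y). dist (f x) (f y) < e) right_uniformity"
        by (auto simp: filterlim_iff case_prod_unfold)
      then obtain Q where "eventually Q (nhds (0::'a))" "\<And>x y. Q (x - y) \<Longrightarrow> dist (f x) (f y) < e"
        unfolding right_uniformity_def eventually_filtercomap by fastforce
      moreover have "(v + x) - x = v" for v x :: 'a by simp
      ultimately show "\<forall>\<^sub>F v in nhds 0. \<forall>x. \<bar>f (v + x) - f x\<bar> < e"
        by (smt (verit) dist_real_def eventually_mono)
    qed
  next
    assume R: ?R
    show ?L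
      unfolding filterlim_iff
    proof (intro allI impI)
      fix P :: "real \<times> real \<Rightarrow> bool"
      assume "eventually P uniformity"
      then obtain e where e: "e > 0" "\<And>x y. dist x y < e \<Longrightarrow> P (x, y)"
        unfolding eventually_uniformity_metric by blast
      have "P (f x, f y)" if "\<forall>z. \<bar>f ((x - y) + z) - f z\<bar> < e" for x y
        using that[rule_format, of y] by (intro e(2)) (simp add: dist_real_def)
      with R e(1) show "\<forall>\<^sub>F p in right_uniformity. P (case p of (x, y) \<Rightarrow> (f x, f y))"
        unfolding right_uniformity_def eventually_filtercomap
        by (intro exI[of _ "\<lambda>v. \<forall>z. \<bar>f (v + z) - f z\<bar> < e"]) auto
    qed
  qed
  moreover have "bounded (range f) \<longleftrightarrow> (\<exists>B. \<forall>x. \<bar>f x\<bar> \<le> B)"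
    by (auto simp: bounded_iff)
  ultimately show ?thesis by (simp add: RUC_b_def)
qed

lemma RUC_bI:
  assumes "\<And>x. \<bar>f x\<bar> \<le> B" and "\<And>e. e > 0 \<Longrightarrow> \<forall>\<^sub>F v in nhds 0. \<forall>x. \<bar>f (v + x) - f x\<bar> < e"
  shows "f \<in> RUC_b"
  using assms by (auto simp: RUC_b_iff)

lemma RUC_b_bounded:
  assumes "f \<in> RUC_b" obtains B where "B > 0" "\<And>x. \<bar>f x\<bar> \<le> B"
proof -
  obtain B where "\<forall>x. \<bar>f x\<bar> \<le> B" using assms by (auto simp: RUC_b_iff)
  then have "\<And>x. \<bar>f x\<bar> \<le> \<bar>B\<bar> + 1" by (meson abs_ge_self add_increasing2 order_trans zero_le_one)
  then show thesis using that[of "\<bar>B\<bar> + 1"] by simp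
qed

lemma RUC_b_unif:
  assumes "f \<in> RUC_b" "e > 0" shows "\<forall>\<^sub>F v in nhds 0. \<forall>x. \<bar>f (v + x) - f x\<bar> < e"
  using assms by (auto simp: RUC_b_iff)

text \<open>One estimate serves for sums (\<open>C = 1\<close>), products (\<open>C = A + B\<close>)
  and reciprocals (\<open>C = 1 / (c * c)\<close>, with a constant as second function).\<close>

lemma RUC_b_lipschitz2:
  assumes f: "f \<in> RUC_b" and h: "h \<in> RUC_b" and "C \<ge> 0"
    and B: "\<And>x. \<bar>k x\<bar> \<le> B"
    and lip: "\<And>x y. \<bar>k x - k y\<bar> \<le> C * (\<bar>f x - f y\<bar> + \<bar>h x - h y\<bar>)"
  shows "k \<in> RUC_b"
proof (rule RUC_bI[OF B])
  fix e :: real assume "e > 0"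
  \<comment> \<open>\<open>C + 1\<close> in place of \<open>C\<close> covers \<open>C = 0\<close>
    and makes the final estimate strict.\<close>
  define d where "d = e / (2 * (C + 1))"
  have d: "d > 0" using \<open>e > 0\<close> \<open>C \<ge> 0\<close> by (simp add: d_def)
  show "\<forall>\<^sub>F v in nhds 0. \<forall>x. \<bar>k (v + x) - k x\<bar> < e"
    using RUC_b_unif[OF f d] RUC_b_unif[OF h d]
  proof eventually_elim
    case (elim v)
    show ?case
    proof
      fix x
      have "\<bar>k (v + x) - k x\<bar> \<le> C * (\<bar>f (v + x) - f x\<bar> + \<bar>h (v + x) - h x\<bar>)" by (rule lip)
      also have "\<dots> \<le> C * (d + d)"
        using elim[rule_format, of x] \<open>C \<ge> 0\<close> by (intro mult_left_mono) auto
      also have "\<dots> < (C + 1) * (d + d)" using d by simp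
      also have "\<dots> = e" using \<open>C \<ge> 0\<close> by (simp add: d_def divide_simps)
      finally show "\<bar>k (v + x) - k x\<bar> < e" .
    qed
  qed
qed

lemma RUC_b_const [simp]: "(\<lambda>_. c) \<in> RUC_b"
  by (rule RUC_bI[of _ "\<bar>c\<bar>"]) auto

lemma RUC_b_add:
  assumes "f \<in> RUC_b" "h \<in> RUC_b" shows "(\<lambda>x. f x + h x) \<in> RUC_b"
proof -
  obtain A B where "\<And>x. \<bar>f x\<bar> \<le> A" "\<And>x. \<bar>h x\<bar> \<le> B"
    using assms by (meson RUC_b_bounded)
  then have "\<And>x. \<bar>f x + h x\<bar> \<le> A + B" by (meson abs_triangle_ineq add_mono order_trans)
  then show ?thesis by (rule RUC_b_lipschitz2[OF assms, of 1, rotated]) auto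
qed

lemma RUC_b_mult:
  assumes "f \<in> RUC_b" "h \<in> RUC_b" shows "(\<lambda>x. f x * h x) \<in> RUC_b"
proof -
  obtain A B where AB: "A > 0" "\<And>x. \<bar>f x\<bar> \<le> A" "B > 0" "\<And>x. \<bar>h x\<bar> \<le> B"
    using assms by (meson RUC_b_bounded)
  have 1: "\<bar>f x * h x\<bar> \<le> A * B" for x using AB by (simp add: abs_mult mult_mono)
  have "\<bar>f x * h x - f y * h y\<bar> \<le> (A + B) * (\<bar>f x - f y\<bar> + \<bar>h x - h y\<bar>)" for x y
  proof -
    have "f x * h x - f y * h y = f x * (h x - h y) + h y * (f x - f y)" by (simp add:
        algebra_simps)
    then have "\<bar>f x * h x - f y * h y\<bar> \<le> \<bar>f x\<bar> * \<bar>h x - h y\<bar> + \<bar>h y\<bar> * \<bar>f x - f y\<bar>"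
      by (metis abs_mult abs_triangle_ineq)
    also have "\<dots> \<le> A * \<bar>h x - h y\<bar> + B * \<bar>f x - f y\<bar>"
      using AB by (intro add_mono mult_right_mono) auto
    also have "\<dots> \<le> (A + B) * (\<bar>f x - f y\<bar> + \<bar>h x - h y\<bar>)"
      using AB by (simp add: algebra_simps add_increasing)
    finally show ?thesis .
  qed
  with 1 AB show ?thesis by (intro RUC_b_lipschitz2[OF assms, of "A + B" _ "A * B"]) auto
qed

lemma RUC_b_scale: "f \<in> RUC_b \<Longrightarrow> (\<lambda>x. c * f x) \<in> RUC_b"
  by (rule RUC_b_mult[OF RUC_b_const])

lemma RUC_b_diff:
  assumes "f \<in> RUC_b" "h \<in> RUC_b" shows "(\<lambda>x. f x - h x) \<in> RUC_b"
  using RUC_b_add[OF assms(1) RUC_b_scale[OF assms(2), of "-1"]] by simp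

lemma RUC_b_sum:
  "(\<And>i. i \<in> I \<Longrightarrow> f i \<in> RUC_b) \<Longrightarrow> (\<lambda>x. \<Sum>i\<in>I. f i x) \<in> RUC_b"
  by (induction I rule: infinite_finite_induct) (simp_all add: RUC_b_add)

text \<open>Left translation by \<open>g\<close> conjugates a displacement:
  \<open>g + (v + x) = (g + v - g) + (g + x)\<close>. Continuity of conjugation is therefore what
  makes \<open>RUC_b\<close> stable under left translations.\<close>

lemma tendsto_conjugate:
  "((\<lambda>v. g + v - g) \<longlongrightarrow> (0 :: 'a::topological_group_add)) (nhds 0)"
proof -
  have "((\<lambda>v. g + v + - g) \<longlongrightarrow> g + 0 + - g) (nhds 0)"
    by (intro tendsto_intros filterlim_ident)
  then show ?thesis by simp
qed

lemma RUC_b_translate: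
  assumes "f \<in> RUC_b" shows "(\<lambda>x. f (g + x)) \<in> RUC_b"
proof -
  obtain B where "\<And>x. \<bar>f x\<bar> \<le> B" using assms by (meson RUC_b_bounded)
  moreover have "\<forall>\<^sub>F v in nhds 0. \<forall>x. \<bar>f (g + (v + x)) - f (g + x)\<bar> < e" if "e > 0" for e
  proof -
    have "\<forall>\<^sub>F v in nhds 0. \<forall>x. \<bar>f (g + v - g + x) - f x\<bar> < e"
      using RUC_b_unif[OF assms that] tendsto_conjugate unfolding filterlim_iff by blast
    then show ?thesis
    proof eventually_elim
      case (elim v)
      show ?case
      proof
        fix x
        show "\<bar>f (g + (v + x)) - f (g + x)\<bar> < e"
          using elim[rule_format, of "g + x"]
          by (simp add: diff_conv_add_uminus add.assoc del: add_uminus_conv_diff)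
      qed
    qed
  qed
  ultimately show ?thesis by (intro RUC_bI[of _ B]) auto
qed

text \<open>The test functions of the variational formula for the affinity; the uniform lower bound
  keeps \<open>1 / a\<close> in \<open>RUC_b\<close>.\<close>

definition RUC_pos :: "('a::topological_group_add \<Rightarrow> real) set"
  where "RUC_pos = {a \<in> RUC_b. \<exists>c>0. \<forall>x. c \<le> a x}"

lemma RUC_posI: "a \<in> RUC_b \<Longrightarrow> c > 0 \<Longrightarrow> (\<And>x. c \<le> a x) \<Longrightarrow> a \<in> RUC_pos"
  by (auto simp: RUC_pos_def)

lemma RUC_posE:
  assumes "a \<in> RUC_pos" obtains c where "c > 0" "\<And>x. c \<le> a x"
  using assms unfolding RUC_pos_def by blast

lemma RUC_pos_RUC_b: "a \<in> RUC_pos \<Longrightarrow> a \<in> RUC_b"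
  by (auto simp: RUC_pos_def)

lemma RUC_pos_gt_0: "a \<in> RUC_pos \<Longrightarrow> 0 < a x"
  by (auto simp: RUC_pos_def) (meson less_le_trans)

lemma RUC_pos_const: "c > 0 \<Longrightarrow> (\<lambda>_. c) \<in> RUC_pos"
  by (rule RUC_posI) auto

lemma RUC_pos_add:
  assumes "a \<in> RUC_pos" "b \<in> RUC_pos" shows "(\<lambda>x. a x + b x) \<in> RUC_pos"
proof -
  obtain c where "c > 0" "\<And>x. c \<le> a x" using assms(1) RUC_posE by blast
  with assms RUC_pos_gt_0[OF assms(2)] show ?thesis
    by (intro RUC_posI[of _ c]) (simp_all add: RUC_pos_RUC_b RUC_b_add add_increasing2 less_imp_le)
qed

lemma RUC_pos_mult:
  assumes "a \<in> RUC_pos" "b \<in> RUC_pos" shows "(\<lambda>x. a x * b x) \<in> RUC_pos"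
proof -
  obtain c where "c > 0" "\<And>x. c \<le> a x" using assms(1) RUC_posE by blast
  moreover obtain d where "d > 0" "\<And>x. d \<le> b x" using assms(2) RUC_posE by blast
  ultimately show ?thesis using assms
    by (intro RUC_posI[of _ "c * d"] mult_mono)
      (simp_all add: less_imp_le RUC_pos_gt_0 RUC_b_mult RUC_pos_RUC_b)
qed

lemma RUC_pos_inverse:
  assumes "a \<in> RUC_pos" shows "(\<lambda>x. 1 / a x) \<in> RUC_pos"
proof -
  obtain c where c: "c > 0" "\<And>x. c \<le> a x" using assms RUC_posE by blast
  obtain B where B: "B > 0" "\<And>x. \<bar>a x\<bar> \<le> B" using RUC_pos_RUC_b[OF assms] by (meson RUC_b_bounded)
  have pos: "a x > 0" for x by (rule RUC_pos_gt_0[OF assms])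
  have "\<bar>1 / a x\<bar> \<le> 1 / c" for x using c pos[of x] by (simp add: frac_le)
  moreover have "\<bar>1 / a x - 1 / a y\<bar> \<le> (1 / (c * c)) * (\<bar>a x - a y\<bar> + \<bar>0 - (0::real)\<bar>)" for x y
  proof -
    have "\<bar>1 / a x - 1 / a y\<bar> = \<bar>a x - a y\<bar> / (a x * a y)"
      using pos[of x] pos[of y] by (simp add: divide_simps abs_mult abs_minus_commute)
    also have "\<dots> \<le> \<bar>a x - a y\<bar> / (c * c)"
      using c pos[of x] pos[of y] by (intro divide_left_mono mult_mono mult_pos_pos) (simp_all
          add: less_imp_le)
    finally show ?thesis by simp
  qed
  ultimately have "(\<lambda>x. 1 / a x) \<in> RUC_b"
    using c(1) by (intro RUC_b_lipschitz2[OF RUC_pos_RUC_b[OF assms] RUC_b_const, of "1 / (c * c)"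
        _ "1 / c" 0]) simp_all
  moreover have "1 / B \<le> 1 / a x" for x using B(2)[of x] pos[of x] by (intro divide_left_mono)
      simp_all
  ultimately show ?thesis using B(1) by (intro RUC_posI[of _ "1 / B"]) simp_all
qed

lemma RUC_pos_translate:
  assumes "a \<in> RUC_pos" shows "(\<lambda>x. a (g + x)) \<in> RUC_pos"
  using assms by (simp add: RUC_pos_def RUC_b_translate) blast

section \<open>Means\<close>

text \<open>Invariance is split off from amenability, since the argument moves among means that are
  not yet invariant.\<close>

definition RUC_mean :: "(('a::topological_group_add \<Rightarrow> real) \<Rightarrow> real) \<Rightarrow> bool"
  where "RUC_mean m \<longleftrightarrow>
    (\<forall>f\<in>RUC_b. \<forall>h\<in>RUC_b. m (\<lambda>x. f x + h x) = m f + m h) \<and>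
    (\<forall>c. \<forall>f\<in>RUC_b. m (\<lambda>x. c * f x) = c * m f) \<and>
    (\<forall>f\<in>RUC_b. (\<forall>x. 0 \<le> f x) \<longrightarrow> 0 \<le> m f) \<and>
    m (\<lambda>_. 1) = 1"

lemma amenable_iff_RUC_mean:
  "amenable TYPE('a::topological_group_add) \<longleftrightarrow>
    (\<exists>m :: ('a \<Rightarrow> real) \<Rightarrow> real. RUC_mean m \<and> (\<forall>f\<in>RUC_b. \<forall>g. m (\<lambda>x. f (g + x)) = m f))"
  by (simp add: amenable_def RUC_mean_def comp_def)

context
  fixes m :: "('a::topological_group_add \<Rightarrow> real) \<Rightarrow> real"
  assumes m: "RUC_mean m"
begin

lemma RUC_mean_add: "f \<in> RUC_b \<Longrightarrow> h \<in> RUC_b \<Longrightarrow> m (\<lambda>x. f x + h x) = m f + m h"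
  using m by (simp add: RUC_mean_def)

lemma RUC_mean_scale: "f \<in> RUC_b \<Longrightarrow> m (\<lambda>x. c * f x) = c * m f"
  using m by (simp add: RUC_mean_def)

lemma RUC_mean_nonneg: "f \<in> RUC_b \<Longrightarrow> (\<And>x. 0 \<le> f x) \<Longrightarrow> 0 \<le> m f"
  using m by (simp add: RUC_mean_def)

lemma RUC_mean_const: "m (\<lambda>_. c) = c"
  using RUC_mean_scale[of "\<lambda>_. 1" c] m by (simp add: RUC_mean_def)

lemma RUC_mean_diff:
  "f \<in> RUC_b \<Longrightarrow> h \<in> RUC_b \<Longrightarrow> m (\<lambda>x. f x - h x) = m f - m h"
  using RUC_mean_add[of f "\<lambda>x. -1 * h x"] RUC_mean_scale[of h "-1"] RUC_b_scale[of h "-1"]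
  by simp

lemma RUC_mean_sum:
  "(\<And>i. i \<in> I \<Longrightarrow> f i \<in> RUC_b) \<Longrightarrow> m (\<lambda>x. \<Sum>i\<in>I. f i x) = (\<Sum>i\<in>I. m (f i))"
  by (induction I rule: infinite_finite_induct)
    (simp_all add: RUC_mean_add RUC_mean_const RUC_b_sum)

lemma RUC_mean_mono:
  "f \<in> RUC_b \<Longrightarrow> h \<in> RUC_b \<Longrightarrow> (\<And>x. f x \<le> h x) \<Longrightarrow> m f \<le> m h"
  using RUC_mean_nonneg[of "\<lambda>x. h x - f x"] RUC_mean_diff[of h f] RUC_b_diff[of h f] by simp

end

lemma RUC_mean_average:
  assumes "finite F" "F \<noteq> {}"
  shows "RUC_mean (\<lambda>f. (\<Sum>x\<in>F. f x) / real (card F))"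
  using assms
  by (auto simp: RUC_mean_def sum.distrib add_divide_distrib sum_nonneg simp flip: sum_distrib_left)

text \<open>Tychonoff's theorem, as function types carry the product topology. It serves for means
  and again for families of Lipschitz functions.\<close>

lemma compact_Collect_coordinatewise:
  fixes S :: "'i \<Rightarrow> 'b::topological_space set"
  assumes "\<And>i. compact (S i)"
  shows "compact {f. \<forall>i. f i \<in> S i}"
proof -
  have "compactin (product_topology (\<lambda>i. euclidean) UNIV) (PiE UNIV S)"
    using assms by (simp add: compactin_PiE)
  then show ?thesis
    by (simp add: euclidean_product_topology PiE_UNIV_domain Pi_def)
qed

text \<open>Each condition evaluates \<open>m\<close> at finitely many functions only, so it is
  closed for pointwise convergence.\<close>

lemma closed_RUC_mean: "closed {m. RUC_mean m}"
  unfolding RUC_mean_def Ball_def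
  by (intro closed_Collect_conj closed_Collect_all closed_Collect_imp open_Collect_const
      closed_Collect_eq closed_Collect_le continuous_intros continuous_on_product_coordinates)

text \<open>This is weak-* compactness of the set of means.\<close>

lemma RUC_mean_compactness:
  fixes C :: "(('a::topological_group_add \<Rightarrow> real) \<times> real) set"
  assumes C: "\<And>f r. (f, r) \<in> C \<Longrightarrow> f \<in> RUC_b"
    and fin: "\<And>D. finite D \<Longrightarrow> D \<subseteq> C \<Longrightarrow> \<exists>m. RUC_mean m \<and> (\<forall>(f, r)\<in>D. r \<le> m f)"
  shows "\<exists>m. RUC_mean m \<and> (\<forall>(f, r)\<in>C. r \<le> m f)"
proof -
  have "\<forall>f::'a \<Rightarrow> real. \<exists>B. f \<in> RUC_b \<longrightarrow> (\<forall>x. \<bar>f x\<bar> \<le> B)"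
    by (meson RUC_b_bounded)
  then obtain B :: "('a \<Rightarrow> real) \<Rightarrow> real" where B: "\<And>f x. f \<in> RUC_b \<Longrightarrow> \<bar>f x\<bar> \<le> B f"
    by metis
  \<comment> \<open>A mean is unconstrained outside \<open>RUC_b\<close>; pinning its values there
    to 0 is what makes the set compact.\<close>
  define K where "K = {m. \<forall>f. m f \<in> (if f \<in> RUC_b then {- B f..B f} else {0})} \<inter> {m. RUC_mean m}"
  have "compact {m :: ('a \<Rightarrow> real) \<Rightarrow> real. \<forall>f. m f \<in> (if f \<in> RUC_b then {- B f..B f} else {0})}"
    by (rule compact_Collect_coordinatewise) auto
  then have "compact K"
    unfolding K_def using closed_RUC_mean by (rule compact_Int_closed)
  have "K \<inter> (\<Inter>p\<in>C. {m. snd p \<le> m (fst p)}) \<noteq> {}"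
  proof (rule compact_imp_fip_image[OF \<open>compact K\<close>])
    show "closed {m. snd p \<le> m (fst p)}" for p :: "('a \<Rightarrow> real) \<times> real"
      by (intro closed_Collect_le continuous_intros continuous_on_product_coordinates)
  next
    fix D assume "finite D" "D \<subseteq> C"
    then obtain m where m: "RUC_mean m" "\<forall>(f, r)\<in>D. r \<le> m f" using fin by blast
    define m' where "m' f = (if f \<in> RUC_b then m f else 0)" for f
    have "RUC_mean m'"
      using m(1) by (simp add: RUC_mean_def m'_def RUC_b_add RUC_b_scale)
    moreover have "m' f \<in> (if f \<in> RUC_b then {- B f..B f} else {0})" for f
    proof (cases "f \<in> RUC_b")
      case True
      then have "- B f \<le> f x" "f x \<le> B f" for x using B[of f x] by auto
      then show ?thesis
        using RUC_mean_mono[OF m(1), of "\<lambda>_. - B f" f] RUC_mean_mono[OF m(1), of f "\<lambda>_. B f"] True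
        by (simp add: m'_def RUC_mean_const[OF m(1)])
    qed (simp add: m'_def)
    moreover have "snd p \<le> m' (fst p)" if "p \<in> D" for p
      using m(2) that C[of "fst p" "snd p"] \<open>D \<subseteq> C\<close> by (auto simp: m'_def)
    ultimately have "m' \<in> K \<inter> (\<Inter>p\<in>D. {m. snd p \<le> m (fst p)})" by (simp add: K_def)
    then show "K \<inter> (\<Inter>p\<in>D. {m. snd p \<le> m (fst p)}) \<noteq> {}" by blast
  qed
  then obtain m where "m \<in> K" "\<And>p. p \<in> C \<Longrightarrow> snd p \<le> m (fst p)" by blast
  then show ?thesis by (intro exI[of _ m]) (auto simp: K_def)
qed

section \<open>From matchings to amenability\<close>

lemma RUC_mean_translate:
  assumes "RUC_mean m" shows "RUC_mean (\<lambda>f. m (\<lambda>x. f (g + x)))"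
  using assms by (simp add: RUC_mean_def RUC_b_translate)

lemma RUC_b_inverse_translate: "a \<in> RUC_pos \<Longrightarrow> (\<lambda>x. 1 / a (g + x)) \<in> RUC_b"
  using RUC_b_translate[OF RUC_pos_RUC_b[OF RUC_pos_inverse]] .

text \<open>A second order Taylor bound. With the coefficient 2 the remainder is
  \<open>u^2 * (1 + 2 * u)\<close>, whose sign dictates the range of \<open>u\<close>.\<close>

lemma inverse_one_add_le:
  fixes u :: real assumes "- (1 / 2) \<le> u" shows "1 / (1 + u) \<le> 1 - u + 2 * u\<^sup>2"
proof -
  have "1 \<le> (1 - u + 2 * u\<^sup>2) * (1 + u)"
  proof -
    have "(1 - u + 2 * u\<^sup>2) * (1 + u) - 1 = u\<^sup>2 * (1 + 2 * u)"
      by (simp add: algebra_simps power2_eq_square power3_eq_cube)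
    also have "\<dots> \<ge> 0" using assms by (intro mult_nonneg_nonneg) auto
    finally show ?thesis by simp
  qed
  then show ?thesis using assms by (simp add: divide_le_eq)
qed

text \<open>
  The condition says that the Hellinger affinity (the integral of the square root of the product)
  of \<open>\<nu>\<close> with every translate of \<open>m\<close> is at least \<open>r\<close>: by the inequality of arithmetic and
  geometric means, the affinity of \<open>\<nu>\<close> and \<open>\<kappa>\<close> is the infimum of \<open>(\<nu> a + \<kappa> (1 / a)) / 2\<close>.
\<close>

definition orbit_affinity_ge ::
    "(('a::topological_group_add \<Rightarrow> real) \<Rightarrow> real) \<Rightarrow> real \<Rightarrow> (('a \<Rightarrow> real) \<Rightarrow> real) \<Rightarrow> bool"
  where "orbit_affinity_ge m r \<nu> \<longleftrightarrow>
    RUC_mean \<nu> \<and> (\<forall>g. \<forall>a\<in>RUC_pos. 2 * r \<le> \<nu> a + m (\<lambda>x. 1 / a (g + x)))"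

text \<open>Weak-* compactness: as \<open>r\<close> is a supremum, any finitely many constraints
  with bounds \<open>s < r\<close> are met by one mean, hence all of them are.\<close>

lemma orbit_affinity_ge_maximal:
  assumes "RUC_mean m" and "orbit_affinity_ge m \<theta> \<mu>"
  shows "\<exists>r \<nu>. \<theta> \<le> r \<and> orbit_affinity_ge m r \<nu> \<and> (\<forall>s \<nu>. orbit_affinity_ge m s \<nu> \<longrightarrow> s \<le> r)"
proof -
  let ?X = "{r. \<exists>\<nu>. orbit_affinity_ge m r \<nu>}"
  define r where "r = Sup ?X"
  \<comment> \<open>The constant test function 1 shows that no affinity exceeds 1, so the supremum
    exists.\<close>
  have le_1: "s \<le> 1" if "orbit_affinity_ge m s \<nu>" for s \<nu>
  proof -
    from that have "\<forall>a\<in>RUC_pos. 2 * s \<le> \<nu> a + m (\<lambda>x. 1 / a (0 + x))"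
      unfolding orbit_affinity_ge_def by blast
    from bspec[OF this RUC_pos_const[OF zero_less_one]] show ?thesis
      using assms(1) that by (simp add: RUC_mean_const orbit_affinity_ge_def)
  qed
  have bdd: "bdd_above ?X"
  proof (rule bdd_aboveI)
    fix s assume "s \<in> ?X"
    then show "s \<le> 1" by (elim CollectE exE) (rule le_1)
  qed
  have ne: "\<theta> \<in> ?X" using assms(2) by blast
  have max: "s \<le> r" if "orbit_affinity_ge m s \<nu>" for s \<nu>
  proof -
    from that have "s \<in> ?X" by (intro CollectI exI)
    then show ?thesis unfolding r_def by (rule cSup_upper[OF _ bdd])
  qed
  define C where "C = {(a, 2 * s - m (\<lambda>x. 1 / a (g + x))) | a g s. a \<in> RUC_pos \<and> s < r}"
  have "\<exists>\<nu>. RUC_mean \<nu> \<and> (\<forall>(f, t)\<in>C. t \<le> \<nu> f)"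
  proof (rule RUC_mean_compactness)
    show "f \<in> RUC_b" if "(f, t) \<in> C" for f t
      using that by (auto simp: C_def RUC_pos_RUC_b)
  next
    fix D assume D: "finite D" "D \<subseteq> C"
    have "\<exists>s<r. \<exists>a g. a \<in> RUC_pos \<and> p = (a, 2 * s - m (\<lambda>x. 1 / a (g + x)))" if "p \<in> D" for p
    using subsetD[OF D(2) that] unfolding C_def mem_Collect_eq by (elim exE conjE) (intro exI conjI)
    then obtain S where S: "\<And>p. p \<in> D \<Longrightarrow> S p < r"
        "\<And>p. p \<in> D \<Longrightarrow> \<exists>a g. a \<in> RUC_pos \<and> p = (a, 2 * S p - m (\<lambda>x. 1 / a (g + x)))"
      by metis
    \<comment> \<open>The extra element \<open>r - 1\<close> keeps \<open>Max\<close> meaningful,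
      and below \<open>r\<close>, when \<open>D\<close> is empty.\<close>
    define s where "s = Max (insert (r - 1) (S ` D))"
    have "s < r" unfolding s_def using S(1) D(1) by auto
    then obtain s' where "s' \<in> ?X" "s < s'"
      unfolding r_def using less_cSupE[of s ?X] ne by blast
    then obtain \<nu> where \<nu>: "orbit_affinity_ge m s' \<nu>" by blast
    have "t \<le> \<nu> f" if ft: "(f, t) \<in> D" for f t
    proof -
      obtain g where g: "f \<in> RUC_pos" "t = 2 * S (f, t) - m (\<lambda>x. 1 / f (g + x))"
        using S(2)[OF ft] by blast
      have "S (f, t) \<le> s" unfolding s_def using ft D(1) by (intro Max_ge) auto
      moreover have "2 * s' \<le> \<nu> f + m (\<lambda>x. 1 / f (g + x))"
        using \<nu> g(1) unfolding orbit_affinity_ge_def by blast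
      ultimately show ?thesis using g(2) \<open>s < s'\<close> by linarith
    qed
    with \<nu> show "\<exists>m. RUC_mean m \<and> (\<forall>(f, r)\<in>D. r \<le> m f)"
      unfolding orbit_affinity_ge_def by blast
  qed
  then obtain \<nu> where \<nu>: "RUC_mean \<nu>" "\<And>f t. (f, t) \<in> C \<Longrightarrow> t \<le> \<nu> f" by blast
  have "2 * r \<le> \<nu> a + m (\<lambda>x. 1 / a (g + x))" if "a \<in> RUC_pos" for a g
  proof (rule dense_le)
    fix y assume "y < 2 * r"
    then have "(a, 2 * (y / 2) - m (\<lambda>x. 1 / a (g + x))) \<in> C"
      unfolding C_def using that by (intro CollectI exI[of _ a] exI[of _ g] exI[of _ "y / 2"]) auto
    from \<nu>(2)[OF this] show "y \<le> \<nu> a + m (\<lambda>x. 1 / a (g + x))" by simp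
  qed
  then have "orbit_affinity_ge m r \<nu>" using \<nu>(1) by (simp add: orbit_affinity_ge_def)
  then show ?thesis using max assms(2) by blast
qed

text \<open>Translating \<open>\<nu>\<close> only permutes the translates of \<open>m\<close>
  against which it is tested, and the condition ranges over all of them.\<close>

lemma orbit_affinity_ge_translate:
  assumes "orbit_affinity_ge m r \<nu>"
  shows "orbit_affinity_ge m r (\<lambda>f. \<nu> (\<lambda>x. f (g + x)))"
proof -
  have "2 * r \<le> \<nu> (\<lambda>x. a (g + x)) + m (\<lambda>x. 1 / a (h + x))" if "a \<in> RUC_pos" for a h
  proof -
    have "2 * r \<le> \<nu> (\<lambda>x. a (g + x)) + m (\<lambda>x. 1 / a (g + (- g + h + x)))"
      using assms RUC_pos_translate[OF that, of g] unfolding orbit_affinity_ge_def by blast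
    moreover have "g + (- g + h + x) = h + x" for x by (simp add: add.assoc[symmetric])
    ultimately show ?thesis by simp
  qed
  then show ?thesis
    using assms by (simp add: orbit_affinity_ge_def RUC_mean_translate)
qed

text \<open>
  If \<open>h\<close> were the square root of the density of \<open>\<nu>'\<close> with respect to \<open>\<nu>\<close>, the functional \<open>\<omega>\<close>
  below would be the square of the midpoint of the square roots of \<open>\<nu>\<close> and \<open>\<nu>'\<close>, of mass less
  than 1 by strict convexity of the Hilbert norm. Its affinities are at least \<open>r\<close> for every \<open>h\<close>,
  and \<open>h = 1 + t f\<close> with a small \<open>t\<close> already pushes the mass below 1.
\<close>

lemma orbit_affinity_ge_improve:
  assumes m: "RUC_mean m" and \<nu>: "orbit_affinity_ge m r \<nu>" and \<nu>': "orbit_affinity_ge m r \<nu>'"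
    and "r > 0" and f: "f \<in> RUC_b" "\<nu> f < \<nu>' f"
  shows "\<exists>s \<omega>. r < s \<and> orbit_affinity_ge m s \<omega>"
proof -
  have mean: "RUC_mean \<nu>" "RUC_mean \<nu>'" using \<nu> \<nu>' by (auto simp: orbit_affinity_ge_def)
  obtain B where B: "B > 0" "\<And>x. \<bar>f x\<bar> \<le> B" using f(1) by (meson RUC_b_bounded)
  define d where "d = \<nu>' f - \<nu> f"
  have "d > 0" using f(2) by (simp add: d_def)
  \<comment> \<open>The first bound gives \<open>\<bar>t * f x\<bar> \<le> 1 / 2\<close>, as the
    Taylor bound requires; the second makes the quadratic error \<open>2 * (t * B)^2\<close> at most
    half of the linear gain \<open>t * d\<close>.\<close>
  define t where "t = min (1 / (2 * B)) (d / (4 * B\<^sup>2))"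
  have t: "t > 0" "t * B \<le> 1 / 2" "4 * B\<^sup>2 * t \<le> d"
    using \<open>d > 0\<close> B(1) by (auto simp: t_def min_def field_simps)
  define h where "h x = 1 + t * f x" for x
  have tf: "\<bar>t * f x\<bar> \<le> t * B" for x using B(2)[of x] t(1) by (simp add: abs_mult)
  have "1 / 2 \<le> h x" for x using tf[of x] t(2) by (simp add: h_def)
  moreover have "h \<in> RUC_b" unfolding h_def[abs_def] by (intro RUC_b_add RUC_b_scale RUC_b_const
      f(1))
  ultimately have h: "h \<in> RUC_pos" by (intro RUC_posI[of h "1/2"]) auto
  have hi: "(\<lambda>x. 1 / h x) \<in> RUC_pos" by (rule RUC_pos_inverse[OF h])
  have h_pos: "h x > 0" for x by (rule RUC_pos_gt_0[OF h])
  have "\<nu> h = 1 + t * \<nu> f"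
    unfolding h_def[abs_def]
    by (simp add: RUC_mean_add[OF mean(1)] RUC_mean_const[OF mean(1)] RUC_mean_scale[OF mean(1)]
        f(1) RUC_b_scale)
  moreover have "\<nu>' (\<lambda>x. 1 / h x) \<le> (1 + 2 * (t * B)\<^sup>2) - t * \<nu>' f"
  proof -
    have "1 / h x \<le> (1 + 2 * (t * B)\<^sup>2) - t * f x" for x
    proof -
      have "1 / h x \<le> 1 - t * f x + 2 * (t * f x)\<^sup>2"
        unfolding h_def using tf[of x] t(2) by (intro inverse_one_add_le) auto
      moreover have "(t * f x)\<^sup>2 \<le> (t * B)\<^sup>2"
        using tf[of x] by (metis abs_ge_zero power2_abs power_mono)
      ultimately show ?thesis by simp
    qed
    then have "\<nu>' (\<lambda>x. 1 / h x) \<le> \<nu>' (\<lambda>x. (1 + 2 * (t * B)\<^sup>2) - t * f x)"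
      by (intro RUC_mean_mono[OF mean(2)] RUC_pos_RUC_b[OF hi] RUC_b_diff RUC_b_scale f(1)
          RUC_b_const)
    also have "\<dots> = (1 + 2 * (t * B)\<^sup>2) - t * \<nu>' f"
      by (simp add: RUC_mean_diff[OF mean(2)] RUC_mean_const[OF mean(2)] RUC_mean_scale[OF
          mean(2)] f(1) RUC_b_scale)
    finally show ?thesis .
  qed
  moreover have "2 * (t * B)\<^sup>2 < t * d"
  proof -
    have "2 * (t * B)\<^sup>2 = t * (2 * B\<^sup>2 * t)" by (simp add: power2_eq_square)
    also have "\<dots> < t * d" using t(1) t(3) B(1) \<open>d > 0\<close> by (intro mult_strict_left_mono) auto
    finally show ?thesis .
  qed
  ultimately have lt: "\<nu> h + \<nu>' (\<lambda>x. 1 / h x) < 2"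
    by (simp add: d_def algebra_simps)
  \<comment> \<open>The expansion of a quarter of the squared sum of the two square roots: the
    doubled cross term is written once as \<open>h\<close> times \<open>\<nu>\<close> and once as
    \<open>1 / h\<close> times \<open>\<nu>'\<close>.\<close>
  define \<omega> where "\<omega> a = \<nu> (\<lambda>x. a x * (1 + h x)) / 4 + \<nu>' (\<lambda>x. a x * (1 + 1 / h x)) / 4" for a
  define M where "M = \<omega> (\<lambda>_. 1)"
  have p: "(\<lambda>x. 1 + h x) \<in> RUC_pos" "(\<lambda>x. 1 + 1 / h x) \<in> RUC_pos"
    by (intro RUC_pos_add RUC_pos_const h hi; simp)+
  note p' = p[THEN RUC_pos_RUC_b]
  have M_eq: "M = 1 / 2 + (\<nu> h + \<nu>' (\<lambda>x. 1 / h x)) / 4"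
    unfolding M_def \<omega>_def
    by (simp add: RUC_mean_add[OF mean(1)] RUC_mean_add[OF mean(2)] RUC_mean_const[OF mean(1)]
        RUC_mean_const[OF mean(2)] RUC_pos_RUC_b[OF h] RUC_pos_RUC_b[OF hi] add_divide_distrib)
  define P Q where "P = \<nu> h" and "Q = \<nu>' (\<lambda>x. 1 / h x)"
  have "0 \<le> P" "0 \<le> Q"
    using RUC_mean_nonneg[OF mean(1) RUC_pos_RUC_b[OF h]] RUC_mean_nonneg[OF mean(2)
        RUC_pos_RUC_b[OF hi]] h_pos
    by (simp_all add: less_imp_le P_def Q_def)
  moreover have "P + Q < 2" "M = 1 / 2 + (P + Q) / 4" using lt M_eq by (simp_all add: P_def Q_def)
  ultimately have M: "0 < M" "M < 1" by (simp_all add: field_simps)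
  have add: "\<omega> (\<lambda>x. a x + b x) = \<omega> a + \<omega> b" if "a \<in> RUC_b" "b \<in> RUC_b" for a b
    using that p' by (simp add: \<omega>_def RUC_mean_add[OF mean(1)] RUC_mean_add[OF mean(2)]
        distrib_right RUC_b_mult add_divide_distrib)
  have scale: "\<omega> (\<lambda>x. c * a x) = c * \<omega> a" if "a \<in> RUC_b" for a c
    using RUC_mean_scale[OF mean(1) RUC_b_mult[OF that p'(1)], of c]
      RUC_mean_scale[OF mean(2) RUC_b_mult[OF that p'(2)], of c]
    by (simp only: \<omega>_def mult.assoc distrib_left[of c] times_divide_eq_right)
  have nonneg: "0 \<le> \<omega> a" if "a \<in> RUC_b" "\<And>x. 0 \<le> a x" for a
  proof -
    have "0 \<le> \<nu> (\<lambda>x. a x * (1 + h x))"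
      using RUC_mean_nonneg[OF mean(1) RUC_b_mult[OF that(1) p'(1)]] that(2) RUC_pos_gt_0[OF p(1)]
      by (simp add: less_imp_le)
    moreover have "0 \<le> \<nu>' (\<lambda>x. a x * (1 + 1 / h x))"
      using RUC_mean_nonneg[OF mean(2) RUC_b_mult[OF that(1) p'(2)]] that(2) RUC_pos_gt_0[OF p(2)]
      by (simp add: less_imp_le)
    ultimately show ?thesis by (simp add: \<omega>_def)
  qed
  have "RUC_mean (\<lambda>a. \<omega> a / M)"
    using M add scale nonneg M_def[symmetric] by (simp add: RUC_mean_def add_divide_distrib)
  \<comment> \<open>\<open>\<nu>\<close> and \<open>\<nu>'\<close> are tested with different
    multiples of \<open>a\<close>, chosen so that the reciprocals average back to
    \<open>1 / a\<close>, because \<open>1 / (1 + h) + 1 / (1 + 1 / h) = 1\<close>.\<close>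
  have key: "2 * r \<le> \<omega> a + m (\<lambda>x. 1 / a (g + x))" if a: "a \<in> RUC_pos" for a g
  proof -
    let ?p = "\<lambda>x. (1 / 2) * (a x * (1 + h x))" and ?q = "\<lambda>x. (1 / 2) * (a x * (1 + 1 / h x))"
    have ap: "(\<lambda>x. a x * (1 + h x)) \<in> RUC_pos" "(\<lambda>x. a x * (1 + 1 / h x)) \<in> RUC_pos"
      by (intro RUC_pos_mult a p)+
    have pq: "?p \<in> RUC_pos" "?q \<in> RUC_pos"
      by (intro RUC_pos_mult[OF RUC_pos_const] ap; simp)+
    have "2 * r \<le> \<nu> ?p + m (\<lambda>x. 1 / ?p (g + x))" "2 * r \<le> \<nu>' ?q + m (\<lambda>x. 1 / ?q (g + x))"
      using \<nu> \<nu>' pq unfolding orbit_affinity_ge_def by blast+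
    moreover have "m (\<lambda>x. 1 / ?p (g + x)) + m (\<lambda>x. 1 / ?q (g + x)) = 2 * m (\<lambda>x. 1 / a (g + x))"
    proof -
      have "1 / ?p y + 1 / ?q y = 2 * (1 / a y)" for y
      proof -
        have "a y > 0" "h y > 0" "1 + h y > 0"
          using RUC_pos_gt_0[OF a, of y] h_pos[of y] by simp_all
        then have "1 + 1 / h y = (1 + h y) / h y" by (simp add: add_divide_distrib)
        then have "1 / ?p y + 1 / ?q y = 2 / (a y * (1 + h y)) + 2 * h y / (a y * (1 + h y))"
          by simp
        also have "\<dots> = 2 * (1 + h y) / (a y * (1 + h y))" by (simp add: add_divide_distrib)
        also have "\<dots> = 2 / a y"
          by (rule nonzero_mult_divide_mult_cancel_right) (use \<open>1 + h y > 0\<close> in simp)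
        finally show ?thesis by simp
      qed
      moreover have "m (\<lambda>x. 1 / ?p (g + x)) + m (\<lambda>x. 1 / ?q (g + x)) = m (\<lambda>x. 1 / ?p (g + x) + 1 /
          ?q (g + x))"
        by (rule RUC_mean_add[OF m pq[THEN RUC_b_inverse_translate], symmetric])
      ultimately show ?thesis
        using RUC_mean_scale[OF m, of "\<lambda>x. 1 / a (g + x)" 2] RUC_b_inverse_translate[OF a]
        by simp
    qed
    moreover have "\<nu> ?p = \<nu> (\<lambda>x. a x * (1 + h x)) / 2" "\<nu>' ?q = \<nu>' (\<lambda>x. a x * (1 + 1 / h x)) / 2"
      using RUC_mean_scale[OF mean(1) RUC_pos_RUC_b[OF ap(1)], of "1/2"]
        RUC_mean_scale[OF mean(2) RUC_pos_RUC_b[OF ap(2)], of "1/2"] by simp_all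
    ultimately show ?thesis by (simp add: \<omega>_def)
  qed
  \<comment> \<open>Affinity scales with the square root of the mass, so normalizing divides the
    bound by \<open>sqrt M\<close>. The test function is rescaled by the same factor.\<close>
  have "2 * (r / sqrt M) \<le> \<omega> a / M + m (\<lambda>x. 1 / a (g + x))" if a: "a \<in> RUC_pos" for a g
  proof -
    define c where "c = sqrt M"
    have c: "c > 0" "M = c * c" using M by (simp_all add: c_def)
    have b: "(\<lambda>x. (1 / c) * a x) \<in> RUC_pos" using c by (intro RUC_pos_mult[OF RUC_pos_const] a) auto
    have "2 * r \<le> \<omega> (\<lambda>x. (1 / c) * a x) + m (\<lambda>x. 1 / ((1 / c) * a (g + x)))" by (rule key[OF b])
    also have "(\<lambda>x. 1 / ((1 / c) * a (g + x))) = (\<lambda>x. c * (1 / a (g + x)))" using c by simp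
    also have "m \<dots> = c * m (\<lambda>x. 1 / a (g + x))"
      by (rule RUC_mean_scale[OF m RUC_b_inverse_translate[OF a]])
    also have "\<omega> (\<lambda>x. (1 / c) * a x) = (1 / c) * \<omega> a" by (rule scale[OF RUC_pos_RUC_b[OF a]])
    finally have "2 * r / c \<le> ((1 / c) * \<omega> a + c * m (\<lambda>x. 1 / a (g + x))) / c"
      using c by (intro divide_right_mono) auto
    also have "\<dots> = \<omega> a / M + m (\<lambda>x. 1 / a (g + x))" using c by (simp add: add_divide_distrib)
    finally show ?thesis by (simp add: c_def)
  qed
  with \<open>RUC_mean (\<lambda>a. \<omega> a / M)\<close> have "orbit_affinity_ge m (r / sqrt M) (\<lambda>a. \<omega> a / M)"
    by (simp add: orbit_affinity_ge_def)
  moreover have "r < r / sqrt M" using \<open>r > 0\<close> M by (simp add: less_divide_eq)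
  ultimately show ?thesis by blast
qed

proposition amenable_of_orbit_affinity:
  fixes m :: "('a::topological_group_add \<Rightarrow> real) \<Rightarrow> real"
  assumes "RUC_mean m" "orbit_affinity_ge m \<theta> m" "\<theta> > 0"
  shows "amenable TYPE('a)"
proof -
  obtain r \<nu> where r: "\<theta> \<le> r" "orbit_affinity_ge m r \<nu>"
      and max: "\<And>s \<nu>. orbit_affinity_ge m s \<nu> \<Longrightarrow> s \<le> r"
    using orbit_affinity_ge_maximal[OF assms(1,2)] by blast
  \<comment> \<open>Dividing by \<open>sqrt M < 1\<close> increases only a positive bound.\<close>
  have "r > 0" using r(1) assms(3) by simp
  have "\<not> \<nu> f < \<nu> (\<lambda>x. f (g + x))" if "f \<in> RUC_b" for f g
    using orbit_affinity_ge_improve[OF assms(1) r(2) orbit_affinity_ge_translate[OF r(2)] \<open>r > 0\<close>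
        that]
      max by force
  moreover have "\<not> \<nu> (\<lambda>x. f (g + x)) < \<nu> f" if "f \<in> RUC_b" for f g
    using orbit_affinity_ge_improve[OF assms(1) orbit_affinity_ge_translate[OF r(2)] r(2) \<open>r > 0\<close>
        that]
      max by force
  ultimately have "\<forall>f\<in>RUC_b. \<forall>g. \<nu> (\<lambda>x. f (g + x)) = \<nu> f" by (meson linorder_less_linear)
  moreover have "RUC_mean \<nu>" using r(2) by (simp add: orbit_affinity_ge_def)
  ultimately show ?thesis unfolding amenable_iff_RUC_mean by blast
qed

section \<open>Limit means of matched sets\<close>

lemma matching_number_witness:
  assumes "finite E"
  obtains D \<phi> where "D \<subseteq> E" "inj_on \<phi> D" "\<phi> ` D \<subseteq> F" "\<And>x. x \<in> D \<Longrightarrow> \<phi> x - x \<in> U"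
    "card D = matching_number E F U"
proof -
  obtain D \<phi> where D: "D \<subseteq> E" "inj_on \<phi> D" "\<phi> ` D \<subseteq> F" "\<forall>x\<in>D. \<phi> x - x \<in> U"
      "matching_number E F U \<le> card D"
    using matching_number_ge_iff[OF assms, of "matching_number E F U" F U] by blast
  have "card D \<le> matching_number E F U"
    using matching_number_ge_iff[OF assms, of "card D" F U] D by blast
  with D that show thesis by (metis order_antisym)
qed

text \<open>If \<open>x\<close> is matched to a nearby \<open>\<phi> x\<close>, then
  \<open>a x + 1 / a (\<phi> x)\<close> is almost at least 2. At least
  \<open>\<theta> * card F\<close> points are matched, so the uniform measure on \<open>F\<close>
  satisfies the affinity bound for \<open>\<theta>\<close> up to a small error, which disappears in
  the limit.\<close>

proposition amenable_of_matchings: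
  assumes "\<theta> > 0"
    and matchings: "\<And>(E :: 'a::topological_group_add set) U. finite E \<Longrightarrow> U \<in> nbhds_neutral \<Longrightarrow>
      \<exists>F. finite F \<and> F \<noteq> {} \<and>
        (\<forall>g\<in>E. real (matching_number F ((\<lambda>x. g + x) ` F) U) \<ge> \<theta> * real (card F))"
  shows "amenable TYPE('a)"
proof -
  define C where
    "C = {(\<lambda>x. a x + 1 / a (g + x), 2 * \<theta> - e) | a (g :: 'a) e. a \<in> RUC_pos \<and> e > 0}"
  have CRUC: "(\<lambda>x. a x + 1 / a (g + x)) \<in> RUC_b" if "a \<in> RUC_pos" for a and g :: 'a
    by (rule RUC_b_add[OF RUC_pos_RUC_b[OF that] RUC_b_inverse_translate[OF that]])
  have "\<exists>m. RUC_mean m \<and> (\<forall>(f, t)\<in>C. t \<le> m f)"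
  proof (rule RUC_mean_compactness)
    show "f \<in> RUC_b" if "(f, t) \<in> C" for f t using that CRUC by (auto simp: C_def)
  next
    fix D assume D: "finite D" "D \<subseteq> C"
    then have "\<forall>p\<in>D. \<exists>a (g :: 'a) e. a \<in> RUC_pos \<and> e > 0 \<and> p = (\<lambda>x. a x + 1 / a (g + x), 2 * \<theta> - e)"
      unfolding C_def by fast
    then obtain A and G :: "_ \<Rightarrow> 'a" and \<epsilon> where p: "\<And>p. p \<in> D \<Longrightarrow> A p \<in> RUC_pos" "\<And>p. p \<in> D \<Longrightarrow> \<epsilon> p > 0"
      "\<And>p. p \<in> D \<Longrightarrow> p = (\<lambda>x. A p x + 1 / A p (G p + x), 2 * \<theta> - \<epsilon> p)"
      by metis
    \<comment> \<open>The tolerance \<open>\<epsilon> p / \<theta>\<close> per matched point adds up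
      to \<open>\<epsilon> p\<close> after multiplication by the proportion
      \<open>\<theta>\<close>.\<close>
    define U where "U = {v. \<forall>p\<in>D. \<forall>x. \<bar>1 / A p (v + x) - 1 / A p x\<bar> < \<epsilon> p / \<theta>}"
    have "\<forall>\<^sub>F v in nhds 0. \<forall>p\<in>D. \<forall>x. \<bar>1 / A p (v + x) - 1 / A p x\<bar> < \<epsilon> p / \<theta>"
      using \<open>finite D\<close> p(1,2) \<open>\<theta> > 0\<close>
      by (intro eventually_ball_finite ballI RUC_b_unif[of "\<lambda>x. 1 / A _ x"] RUC_pos_RUC_b
          RUC_pos_inverse) auto
    then have "U \<in> nbhds_neutral" by (simp add: U_def nbhds_neutral_def)
    then obtain F where F: "finite F" "F \<noteq> {}"
        "\<And>g. g \<in> G ` D \<Longrightarrow> real (matching_number F ((\<lambda>x. g + x) ` F) U) \<ge> \<theta> * real (card F)"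
      using matchings[of "G ` D" U] \<open>finite D\<close> by blast
    have "2 * \<theta> - \<epsilon> p \<le> (\<Sum>x\<in>F. A p x + 1 / A p (G p + x)) / card F" if "p \<in> D" for p
    proof -
      define g where "g = G p"
      define a where "a = A p"
      have a_pos: "a x > 0" for x unfolding a_def by (rule RUC_pos_gt_0[OF p(1)[OF that]])
      obtain X \<phi> where X: "X \<subseteq> F" "inj_on \<phi> X" "\<phi> ` X \<subseteq> (\<lambda>x. g + x) ` F" "\<And>x. x \<in> X \<Longrightarrow> \<phi> x - x \<in> U"
          "card X = matching_number F ((\<lambda>x. g + x) ` F) U"
        using matching_number_witness[OF F(1)] by metis
      have cardX: "\<theta> * real (card F) \<le> card X" using F(3)[of g] X(5) that by (simp add: g_def)
      have pt: "2 - \<epsilon> p / \<theta> \<le> a x + 1 / a (\<phi> x)" if "x \<in> X" for x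
      proof -
        have "\<bar>1 / A p ((\<phi> x - x) + x) - 1 / A p x\<bar> < \<epsilon> p / \<theta>"
          using X(4)[OF that] \<open>p \<in> D\<close> unfolding U_def by blast
        then have "1 / a x - \<epsilon> p / \<theta> \<le> 1 / a (\<phi> x)" by (simp add: a_def)
        moreover have "2 \<le> a x + 1 / a x"
          using a_pos[of x] zero_le_power2[of "a x - 1"] by (simp add: field_simps power2_eq_square)
        ultimately show ?thesis by simp
      qed
      have "(2 * \<theta> - \<epsilon> p) * card F \<le> (\<Sum>x\<in>F. a x + 1 / a (g + x))"
      \<comment> \<open>A negative factor could not be multiplied with the lower bound for
        \<open>card X\<close>; the claim is then trivial, as all summands are positive.\<close>
      proof (cases "2 * \<theta> - \<epsilon> p \<le> 0")
        case True
        then have "(2 * \<theta> - \<epsilon> p) * card F \<le> 0" by (simp add: mult_nonpos_nonneg)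
        also have "\<dots> \<le> (\<Sum>x\<in>F. a x + 1 / a (g + x))"
          using a_pos by (intro sum_nonneg) (simp add: less_imp_le)
        finally show ?thesis .
      next
        case False
        then have "0 \<le> 2 - \<epsilon> p / \<theta>" using \<open>\<theta> > 0\<close> by (simp add: field_simps)
        have "(2 * \<theta> - \<epsilon> p) * card F = (2 - \<epsilon> p / \<theta>) * (\<theta> * card F)"
          using \<open>\<theta> > 0\<close> by (simp add: field_simps)
        also have "\<dots> \<le> (2 - \<epsilon> p / \<theta>) * card X"
          using cardX \<open>0 \<le> 2 - \<epsilon> p / \<theta>\<close> by (rule mult_left_mono)
        also have "\<dots> \<le> (\<Sum>x\<in>X. a x + 1 / a (\<phi> x))"
          using sum_mono[OF pt, of X] by (simp add: mult.commute)
        \<comment> \<open>Injectivity of \<open>\<phi>\<close> makes this a sum over distinct points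
          of the translate; the unmatched points only add positive terms.\<close>
        also have "\<dots> = (\<Sum>x\<in>X. a x) + (\<Sum>y\<in>\<phi> ` X. 1 / a y)"
          using X(2) by (simp add: sum.distrib sum.reindex)
        also have "\<dots> \<le> (\<Sum>x\<in>F. a x) + (\<Sum>y\<in>(\<lambda>x. g + x) ` F. 1 / a y)"
          using F(1) X a_pos by (intro add_mono sum_mono2) (auto simp: less_imp_le)
        also have "\<dots> = (\<Sum>x\<in>F. a x + 1 / a (g + x))"
          by (simp add: sum.distrib sum.reindex)
        finally show ?thesis .
      qed
      then show ?thesis
        using F by (simp add: a_def g_def pos_le_divide_eq card_gt_0_iff)
    qed
    then have "t \<le> (\<Sum>x\<in>F. f x) / card F" if "(f, t) \<in> D" for f t
      using p(3)[OF that] that by (metis (no_types, lifting) fst_conv snd_conv sum.cong)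
    with RUC_mean_average[OF F(1,2)] show "\<exists>m. RUC_mean m \<and> (\<forall>(f, r)\<in>D. r \<le> m f)"
      by (intro exI[of _ "\<lambda>f. (\<Sum>x\<in>F. f x) / real (card F)"]) auto
  qed
  then obtain m where m: "RUC_mean m" "\<And>f t. (f, t) \<in> C \<Longrightarrow> t \<le> m f" by blast
  have "2 * \<theta> \<le> m a + m (\<lambda>x. 1 / a (g + x))" if "a \<in> RUC_pos" for a g
  proof (rule field_le_epsilon)
    fix e :: real assume "e > 0"
    then have "(\<lambda>x. a x + 1 / a (g + x), 2 * \<theta> - e) \<in> C" using that by (auto simp: C_def)
    then have "2 * \<theta> - e \<le> m (\<lambda>x. a x + 1 / a (g + x))" by (rule m(2))
    also have "\<dots> = m a + m (\<lambda>x. 1 / a (g + x))"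
      by (rule RUC_mean_add[OF m(1) RUC_pos_RUC_b[OF that] RUC_b_inverse_translate[OF that]])
    finally show "2 * \<theta> \<le> m a + m (\<lambda>x. 1 / a (g + x)) + e" by simp
  qed
  then have "orbit_affinity_ge m \<theta> m" using m(1) by (simp add: orbit_affinity_ge_def)
  then show ?thesis by (rule amenable_of_orbit_affinity[OF m(1) _ \<open>\<theta> > 0\<close>])
qed

section \<open>Hall's theorem\<close>

text \<open>The induction is that of Halmos and Vaughan.\<close>

theorem hall:
  assumes "finite I" and "\<And>i. i \<in> I \<Longrightarrow> finite (A i)"
    and "\<And>J. J \<subseteq> I \<Longrightarrow> card J \<le> card (\<Union> (A ` J))"
  shows "\<exists>R. inj_on R I \<and> (\<forall>i\<in>I. R i \<in> A i)"
  using assms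
proof (induction "card I" arbitrary: I A rule: less_induct)
  case less
  note fin = less.prems(1,2) and hall = less.prems(3)
  have finU: "finite (\<Union> (A ` J))" if "J \<subseteq> I" for J
    using that fin finite_subset by (intro finite_UN_I) blast+
  show ?case
  proof (cases "I = {}")
    case False
    then obtain i where i: "i \<in> I" by blast
    show ?thesis
    proof (cases "\<exists>J. J \<subset> I \<and> J \<noteq> {} \<and> card J = card (\<Union> (A ` J))")
      case True
      \<comment> \<open>A tight \<open>J\<close> uses up all of its neighbours \<open>?N\<close>, so
        the other indices are matched outside \<open>?N\<close>. Hall's condition survives there:
        applied to \<open>K \<union> J\<close>, it loses exactly
        \<open>card ?N = card J\<close>.\<close>
      then obtain J where J: "J \<subset> I" "J \<noteq> {}" "card J = card (\<Union> (A ` J))" by blast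
      let ?N = "\<Union> (A ` J)"
      have finJ: "finite J" using J(1) fin(1) by (meson finite_subset psubset_imp_subset)
      have "\<exists>R. inj_on R J \<and> (\<forall>i\<in>J. R i \<in> A i)"
      proof (rule less.hyps)
        show "card J < card I" using J(1) fin(1) by (rule psubset_card_mono[rotated])
        show "finite J" by (rule finJ)
        show "finite (A i)" if "i \<in> J" for i using that J(1) fin(2) by blast
        show "card K \<le> card (\<Union> (A ` K))" if "K \<subseteq> J" for K using that J(1) hall[of K] by blast
      qed
      then obtain R1 where R1: "inj_on R1 J" "\<And>i. i \<in> J \<Longrightarrow> R1 i \<in> A i" by blast
      have "\<exists>R. inj_on R (I - J) \<and> (\<forall>i\<in>I - J. R i \<in> A i - ?N)"
      proof (rule less.hyps)
        show "card (I - J) < card I"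
          using J fin(1) by (intro psubset_card_mono) auto
        show "finite (I - J)" using fin(1) by simp
        show "finite (A i - ?N)" if "i \<in> I - J" for i using that fin(2) by simp
        show "card K \<le> card (\<Union>i\<in>K. A i - ?N)" if K: "K \<subseteq> I - J" for K
        proof -
          have "finite K" using K fin(1) by (meson finite_Diff finite_subset)
          then have "card K + card J = card (K \<union> J)"
            using finJ K by (subst card_Un_disjoint) auto
          also have "\<dots> \<le> card (\<Union> (A ` (K \<union> J)))" using K J(1) by (intro hall) auto
          also have "\<Union> (A ` (K \<union> J)) = (\<Union>i\<in>K. A i - ?N) \<union> ?N" by auto
          also have "card \<dots> \<le> card (\<Union>i\<in>K. A i - ?N) + card ?N" by (rule card_Un_le)
          finally show ?thesis using J(3) by simp
        qed
      qed
      then obtain R2 where R2: "inj_on R2 (I - J)" "\<And>i. i \<in> I - J \<Longrightarrow> R2 i \<in> A i - ?N" by blast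
      define R where "R i = (if i \<in> J then R1 i else R2 i)" for i
      have "R i \<in> A i" if "i \<in> I" for i using that R1(2) R2(2) by (auto simp: R_def)
      moreover have "inj_on R I"
      proof (rule inj_onI)
        fix x y assume xy: "x \<in> I" "y \<in> I" "R x = R y"
        show "x = y"
        proof (cases "x \<in> J"; cases "y \<in> J")
          assume "x \<in> J" "y \<in> J"
          then show ?thesis using xy R1(1) by (auto simp: R_def inj_on_def)
        next
          assume "x \<in> J" "y \<notin> J"
          then show ?thesis using xy R1(2)[of x] R2(2)[of y] by (auto simp: R_def)
        next
          assume "x \<notin> J" "y \<in> J"
          then show ?thesis using xy R1(2)[of y] R2(2)[of x] by (force simp: R_def)
        next
          assume "x \<notin> J" "y \<notin> J"
          then show ?thesis using xy R2(1) by (auto simp: R_def inj_on_def)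
        qed
      qed
      ultimately show ?thesis by blast
    next
      case False
      \<comment> \<open>No nonempty proper subset is tight, so each has a neighbour to spare, and
        giving any \<open>x\<close> to \<open>i\<close> does no harm.\<close>
      have "card {i} \<le> card (\<Union> (A ` {i}))" by (rule hall) (use i in simp)
      then have "A i \<noteq> {}" by auto
      then obtain x where x: "x \<in> A i" by blast
      have "\<exists>R. inj_on R (I - {i}) \<and> (\<forall>j\<in>I - {i}. R j \<in> A j - {x})"
      proof (rule less.hyps)
        show "card (I - {i}) < card I" using i fin(1) by (intro psubset_card_mono) auto
        show "finite (I - {i})" using fin(1) by simp
        show "finite (A j - {x})" if "j \<in> I - {i}" for j using that fin(2) by simp
        show "card K \<le> card (\<Union>j\<in>K. A j - {x})" if K: "K \<subseteq> I - {i}" for K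
        proof (cases "K = {}")
          case False': False
          have "K \<subset> I" "K \<subseteq> I" using K i by auto
          with False False' have "card K \<noteq> card (\<Union> (A ` K))" by blast
          with hall[OF \<open>K \<subseteq> I\<close>] have "card K < card (\<Union> (A ` K))" by simp
          have "\<Union> (A ` K) \<subseteq> insert x (\<Union>j\<in>K. A j - {x})" by auto
          moreover have fin': "finite (\<Union>j\<in>K. A j - {x})"
            by (rule finite_subset[OF _ finU[OF \<open>K \<subseteq> I\<close>]]) auto
          ultimately have "card (\<Union> (A ` K)) \<le> card (insert x (\<Union>j\<in>K. A j - {x}))"
            by (intro card_mono) auto
          also have "\<dots> \<le> Suc (card (\<Union>j\<in>K. A j - {x}))" by (metis card_insert_if[OF fin'] le_SucI
              order_refl)
          finally show ?thesis using \<open>card K < card (\<Union> (A ` K))\<close> by simp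
        qed simp
      qed
      then obtain R where R: "inj_on R (I - {i})" "\<And>j. j \<in> I - {i} \<Longrightarrow> R j \<in> A j - {x}" by blast
      define R' where "R' = R(i := x)"
      have "inj_on R' (insert i (I - {i}))"
        using R by (auto simp: R'_def inj_on_def)
      moreover have "\<forall>j\<in>I. R' j \<in> A j" using R(2) x by (auto simp: R'_def)
      ultimately show ?thesis using i by (metis insert_Diff)
    qed
  qed simp
qed

text \<open>The defect version follows by adding \<open>d\<close> dummy elements adjacent to every index.\<close>

corollary hall_defect:
  assumes "finite I" and "\<And>i. i \<in> I \<Longrightarrow> finite (A i)"
    and "\<And>J. J \<subseteq> I \<Longrightarrow> card J \<le> card (\<Union> (A ` J)) + d"
  shows "\<exists>K R. K \<subseteq> I \<and> card I \<le> card K + d \<and> inj_on R K \<and> (\<forall>i\<in>K. R i \<in> A i)"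
proof -
  define B where "B i = Inl ` A i \<union> Inr ` {..<d}" for i
  have "\<exists>R. inj_on R I \<and> (\<forall>i\<in>I. R i \<in> B i)"
  proof (rule hall[OF assms(1)])
    show "finite (B i)" if "i \<in> I" for i using assms(2)[OF that] by (simp add: B_def)
    show "card J \<le> card (\<Union> (B ` J))" if J: "J \<subseteq> I" for J
    proof (cases "J = {}")
      case False
      have "finite (\<Union> (A ` J))" using assms(1,2) J finite_subset by (intro finite_UN_I) blast+
      moreover have "\<Union> (B ` J) = Inl ` \<Union> (A ` J) \<union> Inr ` {..<d}" using False by (auto simp: B_def)
      moreover have "card (Inl ` \<Union> (A ` J) \<union> Inr ` {..<d} :: ('b + nat) set)
          = card (Inl ` \<Union> (A ` J) :: ('b + nat) set) + card (Inr ` {..<d} :: ('b + nat) set)"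
        using \<open>finite (\<Union> (A ` J))\<close> by (intro card_Un_disjoint) auto
      ultimately show ?thesis using assms(3)[OF J] by (simp add: card_image)
    qed simp
  qed
  then obtain R where R: "inj_on R I" "\<And>i. i \<in> I \<Longrightarrow> R i \<in> B i" by blast
  define K where "K = {i \<in> I. isl (R i)}"
  have "card (I - K) = card (R ` (I - K))"
    using R(1) by (intro card_image[symmetric]) (auto intro: inj_on_subset)
  also have "\<dots> \<le> card (Inr ` {..<d} :: ('b + nat) set)"
    using R(2) by (intro card_mono) (fastforce simp: K_def B_def)+
  also have "\<dots> = d" by (simp add: card_image)
  finally have "card I \<le> card K + d"
    using assms(1) by (simp add: K_def card_Diff_subset)
  moreover have "inj_on (projl \<circ> R) K"
  proof (rule comp_inj_on)
    show "inj_on R K" using R(1) by (rule inj_on_subset) (auto simp: K_def)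
    show "inj_on projl (R ` K)" by (auto simp: K_def inj_on_def isl_def)
  qed
  moreover have "\<forall>i\<in>K. (projl \<circ> R) i \<in> A i" using R(2) by (fastforce simp: K_def B_def)
  moreover have "K \<subseteq> I" by (auto simp: K_def)
  ultimately show ?thesis by blast
qed

section \<open>Continuous pseudonorms\<close>

text \<open>
  The construction of Birkhoff and Kakutani: the pseudonorm of \<open>x\<close> is the infimum of the weights of
  the chains with sum \<open>x\<close>, where a summand from \<open>V n\<close> has weight \<open>2\<^sup>-\<^sup>n\<close>.
\<close>

definition chain_weight :: "(nat \<times> 'a) list \<Rightarrow> real"
  where "chain_weight xs = (\<Sum>(n, v)\<leftarrow>xs. (1 / 2) ^ n)"

lemma chain_weight_simps [simp]:
  "chain_weight [] = 0"
  "chain_weight (p # xs) = (1 / 2) ^ fst p + chain_weight xs"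
  "chain_weight (xs @ ys) = chain_weight xs + chain_weight ys"
  by (simp_all add: chain_weight_def case_prod_unfold)

lemma chain_weight_nonneg: "0 \<le> chain_weight xs"
  by (induction xs) auto

lemma chain_weight_uminus:
  "chain_weight (rev (map (\<lambda>(n, v). (n, - v)) xs)) = chain_weight xs"
  by (induction xs) auto

text \<open>The cut is made at the summand \<open>p\<close> whose weight first carries the partial
  sums up to \<open>b\<close>; \<open>zs = []\<close> covers chains too light to get there.\<close>

lemma chain_split:
  assumes "xs \<noteq> []" "0 < b"
  shows "\<exists>ys p zs. xs = ys @ p # zs \<and> chain_weight ys < b \<and>
    (b \<le> chain_weight ys + (1 / 2) ^ fst p \<or> zs = [])"
  using assms
proof (induction xs arbitrary: b)
  case (Cons p xs)
  show ?case
  proof (cases "b \<le> (1 / 2) ^ fst p \<or> xs = []")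
    case True
    then show ?thesis using Cons.prems by (intro exI[of _ "[]"] exI[of _ p] exI[of _ xs]) auto
  next
    case False
    then have "\<exists>ys q zs. xs = ys @ q # zs \<and> chain_weight ys < b - (1 / 2) ^ fst p \<and>
        (b - (1 / 2) ^ fst p \<le> chain_weight ys + (1 / 2) ^ fst q \<or> zs = [])"
      by (intro Cons.IH) auto
    then obtain ys q zs where "xs = ys @ q # zs" "chain_weight ys < b - (1 / 2) ^ fst p"
      "b - (1 / 2) ^ fst p \<le> chain_weight ys + (1 / 2) ^ fst q \<or> zs = []"
      by blast
    then show ?thesis by (intro exI[of _ "p # ys"] exI[of _ q] exI[of _ zs]) auto
  qed
qed simp

context
  fixes V :: "nat \<Rightarrow> 'a::group_add set"
  assumes V0: "V 0 = UNIV"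
    and V_zero: "\<And>n. 0 \<in> V n"
    and V_uminus: "\<And>n v. v \<in> V n \<Longrightarrow> - v \<in> V n"
    and V_add3: "\<And>n u v w. u \<in> V (Suc n) \<Longrightarrow> v \<in> V (Suc n) \<Longrightarrow> w \<in> V (Suc n) \<Longrightarrow> u + v + w \<in> V n"
begin

definition chain :: "'a \<Rightarrow> (nat \<times> 'a) list \<Rightarrow> bool"
  where "chain x xs \<longleftrightarrow> (\<forall>(n, v)\<in>set xs. v \<in> V n) \<and> x = sum_list (map snd xs)"

lemma chain_append: "chain x xs \<Longrightarrow> chain y ys \<Longrightarrow> chain (x + y) (xs @ ys)"
  by (auto simp: chain_def)

lemma chain_uminus:
  "chain x xs \<Longrightarrow> chain (- x) (rev (map (\<lambda>(n, v). (n, - v)) xs))"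
proof (induction xs arbitrary: x)
  case (Cons p xs)
  obtain n v where p: "p = (n, v)" by fastforce
  have "chain (sum_list (map snd xs)) xs" using Cons.prems by (simp add: chain_def)
  moreover have "chain (- v) [(n, - v)]" using Cons.prems V_uminus by (simp add: chain_def p)
  ultimately have "chain (- sum_list (map snd xs) + - v) (rev (map (\<lambda>(n, v). (n, - v)) xs) @ [(n,
      - v)])"
    by (intro chain_append Cons.IH)
  moreover have "- x = - sum_list (map snd xs) + - v"
    using Cons.prems by (simp add: chain_def p minus_add del: add_uminus_conv_diff)
  ultimately show ?case by (simp add: p)
qed (simp add: chain_def)

lemma V_Suc_subset: "V (Suc n) \<subseteq> V n"
  using V_add3[OF _ V_zero V_zero] by auto

lemma V_antimono: "m \<le> n \<Longrightarrow> V n \<subseteq> V m"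
  by (rule lift_Suc_antimono_le[of V]) (rule V_Suc_subset)

text \<open>Cut at half of \<open>(1 / 2) ^ n\<close>: both outer pieces weigh less than this half
  and lie in \<open>V (Suc n)\<close> by induction, and the summand between them has index above
  \<open>n\<close>. These three pieces are the reason for the threefold sums in the hypothesis on
  \<open>V\<close>.\<close>

lemma chain_in_V:
  assumes "chain x xs" "chain_weight xs < (1 / 2) ^ n"
  shows "x \<in> V n"
  using assms
proof (induction xs arbitrary: x n rule: length_induct)
  case (1 xs)
  show ?case
  proof (cases "xs = []")
    case True
    then show ?thesis using 1 V_zero by (simp add: chain_def)
  next
    case False
    let ?b = "(1 / 2 :: real) ^ Suc n"
    obtain ys p zs where s: "xs = ys @ p # zs" "chain_weight ys < ?b"
      "?b \<le> chain_weight ys + (1 / 2) ^ fst p \<or> zs = []"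
      using chain_split[OF False, of ?b] by auto
    have zs: "chain_weight zs < ?b" using s 1(3) by auto
    have "chain_weight ys + ((1 / 2) ^ fst p + chain_weight zs) < (1 / 2) ^ n"
      using 1(3) s(1) by simp
    then have "(1 / 2 :: real) ^ fst p < (1 / 2) ^ n"
      using chain_weight_nonneg[of ys] chain_weight_nonneg[of zs] by linarith
    then have "n < fst p" by simp
    moreover have "snd p \<in> V (fst p)" using 1(2) s(1) by (auto simp: chain_def)
    ultimately have "snd p \<in> V (Suc n)" using V_antimono[of "Suc n" "fst p"] by auto
    moreover have "sum_list (map snd ys) \<in> V (Suc n)"
      using 1(1)[rule_format, of ys] 1(2) s by (auto simp: chain_def)
    moreover have "sum_list (map snd zs) \<in> V (Suc n)"
      using 1(1)[rule_format, of zs] 1(2) s zs by (auto simp: chain_def)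
    ultimately have "sum_list (map snd ys) + snd p + sum_list (map snd zs) \<in> V n" by (intro V_add3)
    then show ?thesis using 1(2) s(1) by (simp add: chain_def add.assoc)
  qed
qed

text \<open>\<open>V 0 = UNIV\<close> provides a chain for every element, so the infimum is taken
  over a nonempty set. Chains of length one give the upper bound on \<open>V n\<close>, and
  \<open>chain_in_V\<close> gives the converse.\<close>

lemma pseudonorm_of_V:
  "\<exists>\<rho> :: 'a \<Rightarrow> real. \<rho> 0 = 0 \<and> (\<forall>x. \<rho> (- x) = \<rho> x) \<and> (\<forall>x y. \<rho> (x + y) \<le> \<rho> x + \<rho> y) \<and>
    (\<forall>n. \<forall>x\<in>V n. \<rho> x \<le> (1 / 2) ^ n) \<and> (\<forall>n x. \<rho> x < (1 / 2) ^ n \<longrightarrow> x \<in> V n)"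
proof -
  define W where "W x = {chain_weight xs | xs. chain x xs}" for x
  define \<rho> where "\<rho> x = Inf (W x)" for x
  have single: "(1 / 2) ^ n \<in> W x" if "x \<in> V n" for x n
    using that by (auto simp: W_def chain_def intro!: exI[of _ "[(n, x)]"])
  have ne: "W x \<noteq> {}" for x using single[of x 0] V0 by auto
  have nonneg: "0 \<le> c" if "c \<in> W x" for c x using that chain_weight_nonneg by (auto simp: W_def)
  then have bdd: "bdd_below (W x)" for x by (meson bdd_below.I)
  have \<rho>_le: "\<rho> x \<le> c" if "c \<in> W x" for c x
    unfolding \<rho>_def using that bdd by (rule cInf_lower)
  have \<rho>_nonneg: "0 \<le> \<rho> x" for x
    unfolding \<rho>_def using ne nonneg by (rule cInf_greatest)
  have \<rho>_less: "\<exists>c\<in>W x. c < t" if "\<rho> x < t" for x t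
    using that ne bdd unfolding \<rho>_def by (simp add: cInf_less_iff)
  have "0 \<in> W 0" by (auto simp: W_def chain_def intro!: exI[of _ "[]"])
  then have "\<rho> 0 = 0" using \<rho>_le[of 0 0] \<rho>_nonneg[of 0] by simp
  moreover have "\<rho> (- x) = \<rho> x" for x
  proof -
    have sub: "W y \<subseteq> W (- y)" for y
    proof
      fix c assume "c \<in> W y"
      then obtain xs where "chain y xs" "c = chain_weight xs" by (auto simp: W_def)
      then show "c \<in> W (- y)"
        using chain_uminus[of y xs] chain_weight_uminus[of xs] unfolding W_def by (intro CollectI
            exI conjI) simp_all
    qed
    have "W (- x) = W x" using sub[of x] sub[of "- x"] by auto
    then show ?thesis by (simp add: \<rho>_def)
  qed
  moreover have "\<rho> (x + y) \<le> \<rho> x + \<rho> y" for x y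
  proof (rule field_le_epsilon)
    fix e :: real assume "e > 0"
    then obtain c d where cd: "c \<in> W x" "c < \<rho> x + e / 2" "d \<in> W y" "d < \<rho> y + e / 2"
      using \<rho>_less[of x "\<rho> x + e / 2"] \<rho>_less[of y "\<rho> y + e / 2"] by auto
    then obtain xs ys where "chain x xs" "c = chain_weight xs" "chain y ys" "d = chain_weight ys"
      by (auto simp: W_def)
    then have "chain (x + y) (xs @ ys)" "c + d = chain_weight (xs @ ys)"
      by (simp_all add: chain_append)
    then have "c + d \<in> W (x + y)" unfolding W_def by blast
    then show "\<rho> (x + y) \<le> \<rho> x + \<rho> y + e" using \<rho>_le cd by fastforce
  qed
  moreover have "\<rho> x \<le> (1 / 2) ^ n" if "x \<in> V n" for x n using \<rho>_le single that by blast
  moreover have "x \<in> V n" if "\<rho> x < (1 / 2) ^ n" for x n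
    using \<rho>_less[OF that] chain_in_V by (auto simp: W_def)
  ultimately show ?thesis by blast
qed

end

section \<open>Pseudonorms adapted to a neighbourhood\<close>

lemma nbhds_neutral_split3:
  fixes U :: "'a::topological_group_add set"
  assumes "U \<in> nbhds_neutral"
  shows "\<exists>V\<in>nbhds_neutral. (\<forall>v\<in>V. - v \<in> V) \<and> (\<forall>u\<in>V. \<forall>v\<in>V. \<forall>w\<in>V. u + v + w \<in> U)"
proof -
  have "((\<lambda>(u, v, w). u + v + w) \<longlongrightarrow> (0 :: 'a) + 0 + 0) (nhds 0 \<times>\<^sub>F nhds 0 \<times>\<^sub>F nhds 0)"
    unfolding case_prod_unfold
    by (intro tendsto_intros filterlim_fst filterlim_compose[OF filterlim_fst filterlim_snd]
        filterlim_compose[OF filterlim_snd filterlim_snd])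
  moreover have "\<forall>\<^sub>F x in nhds (0 + 0 + 0). x \<in> U" using assms by (simp add: nbhds_neutral_def)
  ultimately have "\<forall>\<^sub>F p in nhds 0 \<times>\<^sub>F nhds 0 \<times>\<^sub>F nhds 0. (case p of (u, v, w) \<Rightarrow> u + v + w) \<in> U"
    by (rule eventually_compose_filterlim[rotated])
  then obtain P Q R where PQR: "eventually P (nhds (0 :: 'a))" "eventually Q (nhds (0 :: 'a))"
      "eventually R (nhds (0 :: 'a))" "\<And>u v w. P u \<Longrightarrow> Q v \<Longrightarrow> R w \<Longrightarrow> u + v + w \<in> U"
    unfolding eventually_prod_filter by auto
  define S where "S x \<longleftrightarrow> P x \<and> Q x \<and> R x" for x
  have S: "eventually S (nhds 0)" unfolding S_def using PQR(1-3) by (intro eventually_conj)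
  moreover have "((\<lambda>x. - x) \<longlongrightarrow> (0 :: 'a)) (nhds 0)" using tendsto_uminus_nhds[of "0 :: 'a"] by simp
  ultimately have "\<forall>\<^sub>F x in nhds 0. S (- x)" by (simp add: filterlim_iff)
  with S have "{x. S x \<and> S (- x)} \<in> nbhds_neutral" by (simp add: nbhds_neutral_def eventually_conj)
  then show ?thesis using PQR(4) by (intro bexI[of _ "{x. S x \<and> S (- x)}"]) (auto simp: S_def)
qed

lemma nbhds_neutral_UNIV: "UNIV \<in> nbhds_neutral"
  by (simp add: nbhds_neutral_def)

lemma nbhds_neutral_Int: "U \<in> nbhds_neutral \<Longrightarrow> V \<in> nbhds_neutral \<Longrightarrow> U \<inter> V \<in> nbhds_neutral"
  by (simp add: nbhds_neutral_def eventually_conj)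

lemma zero_in_nbhds_neutral: "U \<in> nbhds_neutral \<Longrightarrow> 0 \<in> U"
  unfolding nbhds_neutral_def by (auto dest: eventually_nhds_x_imp_x)

definition continuous_pseudonorm :: "('a::topological_group_add \<Rightarrow> real) \<Rightarrow> bool"
  where "continuous_pseudonorm \<rho> \<longleftrightarrow> \<rho> 0 = 0 \<and> (\<forall>x. \<rho> (- x) = \<rho> x) \<and>
    (\<forall>x y. \<rho> (x + y) \<le> \<rho> x + \<rho> y) \<and> (\<forall>e>0. \<forall>\<^sub>F v in nhds 0. \<rho> v < e)"

lemma continuous_pseudonorm_exists:
  fixes U :: "'a::topological_group_add set"
  assumes U: "U \<in> nbhds_neutral"
  shows "\<exists>\<rho>. continuous_pseudonorm \<rho> \<and> (\<forall>x. \<rho> x < 1 \<longrightarrow> x \<in> U)"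
proof -
  \<comment> \<open>Intersecting with \<open>U\<close> in each step forces
    \<open>V 1 \<subseteq> U\<close>, while \<open>V 0\<close> remains the whole group, as the chain
    construction demands.\<close>
  have "\<exists>V :: nat \<Rightarrow> 'a set. \<forall>n. (V n \<in> nbhds_neutral \<and> (\<forall>v\<in>V n. - v \<in> V n) \<and> (n = 0 \<longrightarrow> V n = UNIV)) \<and>
      (\<forall>u\<in>V (Suc n). \<forall>v\<in>V (Suc n). \<forall>w\<in>V (Suc n). u + v + w \<in> V n \<inter> U)"
  proof (rule dependent_nat_choice)
    show "\<exists>V :: 'a set. V \<in> nbhds_neutral \<and> (\<forall>v\<in>V. - v \<in> V) \<and> (0 = (0::nat) \<longrightarrow> V = UNIV)"
      by (intro exI[of _ UNIV]) (simp add: nbhds_neutral_UNIV)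
    fix V :: "'a set" and n :: nat
    assume V: "V \<in> nbhds_neutral \<and> (\<forall>v\<in>V. - v \<in> V) \<and> (n = 0 \<longrightarrow> V = UNIV)"
    then have "V \<inter> U \<in> nbhds_neutral" using U nbhds_neutral_Int by blast
    from nbhds_neutral_split3[OF this]
    show "\<exists>W. (W \<in> nbhds_neutral \<and> (\<forall>v\<in>W. - v \<in> W) \<and> (Suc n = 0 \<longrightarrow> W = UNIV)) \<and>
        (\<forall>u\<in>W. \<forall>v\<in>W. \<forall>w\<in>W. u + v + w \<in> V \<inter> U)"
      by auto
  qed
  then obtain V :: "nat \<Rightarrow> 'a set" where V: "\<And>n. V n \<in> nbhds_neutral" "\<And>n v. v \<in> V n \<Longrightarrow> - v \<in> V n"
    "V 0 = UNIV" "\<And>n u v w. u \<in> V (Suc n) \<Longrightarrow> v \<in> V (Suc n) \<Longrightarrow> w \<in> V (Suc n) \<Longrightarrow> u + v + w \<in> V n \<inter> U"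
    by (metis (no_types, lifting))
  have V_zero: "0 \<in> V n" for n by (rule zero_in_nbhds_neutral[OF V(1)])
  have "V 1 \<subseteq> U" using V(4)[of _ 0, OF _ V_zero V_zero] by auto
  have "\<exists>\<rho> :: 'a \<Rightarrow> real. \<rho> 0 = 0 \<and> (\<forall>x. \<rho> (- x) = \<rho> x) \<and> (\<forall>x y. \<rho> (x + y) \<le> \<rho> x + \<rho> y) \<and>
    (\<forall>n. \<forall>x\<in>V n. \<rho> x \<le> (1 / 2) ^ n) \<and> (\<forall>n x. \<rho> x < (1 / 2) ^ n \<longrightarrow> x \<in> V n)"
    using V V_zero by (intro pseudonorm_of_V) auto
  then obtain \<rho> :: "'a \<Rightarrow> real" where \<rho>: "\<rho> 0 = 0" "\<And>x. \<rho> (- x) = \<rho> x" "\<And>x y. \<rho> (x + y) \<le> \<rho> x + \<rho> y"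
    "\<And>n x. x \<in> V n \<Longrightarrow> \<rho> x \<le> (1 / 2) ^ n" "\<And>n x. \<rho> x < (1 / 2) ^ n \<Longrightarrow> x \<in> V n"
    by blast
  have "\<forall>\<^sub>F v in nhds 0. 2 * \<rho> v < e" if "e > 0" for e
  proof -
    obtain n where n: "(1 / 2 :: real) ^ n < e / 2"
      using real_arch_pow_inv[of "e / 2" "1 / 2"] \<open>e > 0\<close> by auto
    have "\<forall>\<^sub>F v in nhds 0. v \<in> V n" using V(1) by (simp add: nbhds_neutral_def)
    then show ?thesis
    proof eventually_elim
      case (elim v)
      show ?case using \<rho>(4)[OF elim] n by simp
    qed
  qed
  moreover have "2 * \<rho> (x + y) \<le> 2 * \<rho> x + 2 * \<rho> y" for x y using \<rho>(3)[of x y] by simp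
  \<comment> \<open>Doubling moves the threshold for membership in \<open>V 1\<close> from 1/2 to
    1.\<close>
  ultimately have "continuous_pseudonorm (\<lambda>x. 2 * \<rho> x)"
    using \<rho>(1,2) by (simp add: continuous_pseudonorm_def)
  moreover have "x \<in> U" if "2 * \<rho> x < 1" for x
    using \<rho>(5)[of x 1] that \<open>V 1 \<subseteq> U\<close> by auto
  ultimately show ?thesis by blast
qed

section \<open>From amenability to matchings\<close>

text \<open>
  A near-minimizer of the squared deficit must have small deficit, since otherwise moving towards
  the reply to the weights proportional to its deficits would decrease the squared deficit by a
  definite amount.
\<close>

lemma finite_minimax:
  fixes C :: "('x \<Rightarrow> real) set"
  assumes X: "finite X" and "C \<noteq> {}"
    and conv: "\<And>c d t. c \<in> C \<Longrightarrow> d \<in> C \<Longrightarrow> 0 \<le> t \<Longrightarrow> t \<le> 1 \<Longrightarrow> (\<lambda>x. (1 - t) * c x + t * d x) \<in> C"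
    and bound: "\<And>c x. c \<in> C \<Longrightarrow> x \<in> X \<Longrightarrow> \<bar>c x\<bar> \<le> B"
    and reply: "\<And>w. (\<And>x. 0 \<le> w x) \<Longrightarrow> sum w X = 1 \<Longrightarrow> \<exists>c\<in>C. e \<le> (\<Sum>x\<in>X. w x * c x)"
    and "0 < \<delta>"
  shows "\<exists>c\<in>C. \<forall>x\<in>X. e - \<delta> \<le> c x"
proof -
  define dec where "dec c x = max 0 (e - c x)" for c :: "'x \<Rightarrow> real" and x
  define \<phi> where "\<phi> c = (\<Sum>x\<in>X. (dec c x)\<^sup>2)" for c
  define I where "I = Inf (\<phi> ` C)"
  have \<phi>_nonneg: "0 \<le> \<phi> c" for c by (simp add: \<phi>_def sum_nonneg)
  have bdd: "bdd_below (\<phi> ` C)" using \<phi>_nonneg by (auto intro: bdd_belowI[of _ 0])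
  have I_le: "I \<le> \<phi> c" if "c \<in> C" for c
    unfolding I_def using that by (intro cInf_lower bdd) simp
  have near: "\<exists>c\<in>C. \<phi> c < t" if "I < t" for t
    using that cInf_less_iff[OF _ bdd, of t] \<open>C \<noteq> {}\<close> by (auto simp: I_def)
  have "I < \<delta>\<^sup>2"
  proof (rule ccontr)
    assume "\<not> I < \<delta>\<^sup>2"
    moreover have "0 < \<delta>\<^sup>2" using \<open>0 < \<delta>\<close> by simp
    ultimately have "0 < I" by linarith
    define K where "K = (\<Sum>x\<in>X. (\<bar>e\<bar> + B)\<^sup>2)"
    have sq: "(\<Sum>x\<in>X. (e - c x)\<^sup>2) \<le> K" if "c \<in> C" for c
      unfolding K_def
    proof (rule sum_mono)
      fix x assume "x \<in> X"
      have "\<bar>e - c x\<bar> \<le> \<bar>e\<bar> + B" using bound[OF that \<open>x \<in> X\<close>] by linarith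
      then show "(e - c x)\<^sup>2 \<le> (\<bar>e\<bar> + B)\<^sup>2" by (metis abs_ge_zero power2_abs power_mono)
    qed
    have \<phi>_le_K: "\<phi> c \<le> K" if "c \<in> C" for c
    proof -
      have "\<phi> c \<le> (\<Sum>x\<in>X. (e - c x)\<^sup>2)"
        unfolding \<phi>_def dec_def by (intro sum_mono) (auto simp: max_def)
      with sq[OF that] show ?thesis by linarith
    qed
    have "0 < K" using I_le \<phi>_le_K \<open>0 < I\<close> \<open>C \<noteq> {}\<close> by force
    \<comment> \<open>The margin \<open>I\<^sup>2 / (2 * K)\<close> is exactly what the move from
      \<open>c\<close> to \<open>c'\<close> will gain.\<close>
    have "I < I + I\<^sup>2 / (2 * K)" using \<open>0 < I\<close> \<open>0 < K\<close> by simp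
    then obtain c where c: "c \<in> C" "\<phi> c < I + I\<^sup>2 / (2 * K)" using near by blast
    have "I \<le> K" using I_le[OF c(1)] \<phi>_le_K[OF c(1)] by linarith
    define s where "s = (\<Sum>x\<in>X. dec c x)"
    have dec_nonneg: "0 \<le> dec c x" for x by (simp add: dec_def)
    have "s \<noteq> 0"
    proof
      assume "s = 0"
      then have "\<forall>x\<in>X. dec c x = 0"
        unfolding s_def using X dec_nonneg by (simp add: sum_nonneg_eq_0_iff)
      then have "\<phi> c = 0" by (simp add: \<phi>_def)
      with I_le[OF c(1)] \<open>0 < I\<close> show False by simp
    qed
    moreover have "0 \<le> s" unfolding s_def by (intro sum_nonneg dec_nonneg)
    ultimately have "0 < s" by simp
    have "\<exists>d\<in>C. e \<le> (\<Sum>x\<in>X. dec c x / s * d x)"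
    proof (rule reply)
      show "0 \<le> dec c x / s" for x using dec_nonneg \<open>0 < s\<close> by simp
      show "(\<Sum>x\<in>X. dec c x / s) = 1"
        using \<open>0 < s\<close> by (simp add: s_def flip: sum_divide_distrib)
    qed
    then obtain d where d: "d \<in> C" "e \<le> (\<Sum>x\<in>X. dec c x / s * d x)" by blast
    have "(\<Sum>x\<in>X. dec c x / s * d x) = (\<Sum>x\<in>X. dec c x * d x) / s"
      by (simp add: sum_divide_distrib)
    with d(2) \<open>0 < s\<close> have "e * s \<le> (\<Sum>x\<in>X. dec c x * d x)"
      by (simp add: pos_le_divide_eq)
    \<comment> \<open>The term of the squared deficit that is linear in the direction of
      \<open>d\<close> has the favourable sign, by the choice of the weights.\<close>
    then have cross: "(\<Sum>x\<in>X. dec c x * (e - d x)) \<le> 0"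
      by (simp add: s_def right_diff_distrib sum_subtractf sum_distrib_left mult.commute)
    \<comment> \<open>The minimizer of \<open>- 2 * t * I + 2 * t^2 * K\<close>, which bounds the
      change of the squared deficit.\<close>
    define t where "t = I / (2 * K)"
    have t: "0 < t" "t \<le> 1 / 2" using \<open>0 < I\<close> \<open>0 < K\<close> \<open>I \<le> K\<close> by (auto simp: t_def field_simps)
    define c' where "c' = (\<lambda>x. (1 - t) * c x + t * d x)"
    have "c' \<in> C" unfolding c'_def using t by (intro conv c d) auto
    have "(dec c' x)\<^sup>2 \<le> ((1 - t) * dec c x + t * (e - d x))\<^sup>2" for x
    proof -
      have "e - c' x = (1 - t) * (e - c x) + t * (e - d x)" by (simp add: c'_def algebra_simps)
      also have "\<dots> \<le> (1 - t) * dec c x + t * (e - d x)"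
        using t by (intro add_right_mono mult_left_mono) (auto simp: dec_def)
      finally show ?thesis unfolding dec_def[of c'] by (auto simp: max_def intro: power_mono)
    qed
    then have "\<phi> c' \<le> (\<Sum>x\<in>X. ((1 - t) * dec c x + t * (e - d x))\<^sup>2)"
      unfolding \<phi>_def by (rule sum_mono)
    also have "\<dots> = (\<Sum>x\<in>X. (1 - t)\<^sup>2 * (dec c x)\<^sup>2 + 2 * t * (1 - t) * (dec c x * (e - d x)) + t\<^sup>2
        * (e - d x)\<^sup>2)"
    proof -
      have "((1 - t) * a + t * b)\<^sup>2 = (1 - t)\<^sup>2 * a\<^sup>2 + 2 * t * (1 - t) * (a * b) + t\<^sup>2 * b\<^sup>2" for
          a b
        by (simp add: power2_eq_square algebra_simps)
      then show ?thesis by simp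
    qed
    also have "\<dots> = (1 - t)\<^sup>2 * \<phi> c + 2 * t * (1 - t) * (\<Sum>x\<in>X. dec c x * (e - d x)) + t\<^sup>2 * (\<Sum>x\<in>X.
        (e - d x)\<^sup>2)"
      by (simp add: sum.distrib sum_distrib_left \<phi>_def)
    also have "\<dots> \<le> (1 - t)\<^sup>2 * \<phi> c + 0 + t\<^sup>2 * K"
      using cross t sq[OF d(1)]
      by (intro add_mono mult_left_mono order_refl mult_nonneg_nonpos) auto
    also have "\<dots> = \<phi> c - 2 * t * \<phi> c + t\<^sup>2 * (\<phi> c + K)"
      by (simp add: power2_eq_square algebra_simps)
    also have "\<dots> \<le> \<phi> c - 2 * t * I + t\<^sup>2 * (K + K)"
      using t I_le[OF c(1)] \<phi>_le_K[OF c(1)]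
      by (intro add_mono diff_mono mult_left_mono order_refl) auto
    also have "\<dots> = \<phi> c - I\<^sup>2 / (2 * K)"
      using \<open>0 < K\<close> by (simp add: t_def power2_eq_square field_simps)
    also have "\<dots> < I" using c(2) by simp
    finally show False using I_le[OF \<open>c' \<in> C\<close>] by simp
  qed
  then obtain c where c: "c \<in> C" "\<phi> c < \<delta>\<^sup>2" using near by blast
  have "e - \<delta> \<le> c x" if "x \<in> X" for x
  proof -
    have "(dec c x)\<^sup>2 \<le> \<phi> c"
      unfolding \<phi>_def using X that by (intro member_le_sum) auto
    then have "(dec c x)\<^sup>2 < \<delta>\<^sup>2" using c(2) by simp
    then have "dec c x < \<delta>" by (rule power_less_imp_less_base) (use \<open>0 < \<delta>\<close> in simp)
    then show ?thesis by (simp add: dec_def)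
  qed
  with c(1) show ?thesis by blast
qed

section \<open>Almost invariance, uniformly over Lipschitz functions\<close>

definition unit_lipschitz :: "('a::group_add \<Rightarrow> real) \<Rightarrow> ('a \<Rightarrow> real) set"
  where "unit_lipschitz \<rho> = {f. (\<forall>x. 0 \<le> f x \<and> f x \<le> 1) \<and> (\<forall>x y. \<bar>f x - f y\<bar> \<le> \<rho> (x - y))}"

lemma unit_lipschitzD:
  assumes "f \<in> unit_lipschitz \<rho>"
  shows "0 \<le> f x" "f x \<le> 1" "\<bar>f x - f y\<bar> \<le> \<rho> (x - y)"
  using assms by (auto simp: unit_lipschitz_def)

text \<open>The pseudometric \<open>\<rho> (x - y)\<close> is right invariant: a displacement
  \<open>v\<close> on the left changes \<open>f\<close> by at most \<open>\<rho> v\<close>, wherever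
  it is applied.\<close>

lemma unit_lipschitz_RUC_b:
  assumes "continuous_pseudonorm \<rho>" "f \<in> unit_lipschitz \<rho>" shows "f \<in> RUC_b"
proof (rule RUC_bI)
  show "\<bar>f x\<bar> \<le> 1" for x using unit_lipschitzD(1,2)[OF assms(2), of x] by simp
  fix e :: real assume "e > 0"
  then have "\<forall>\<^sub>F v in nhds 0. \<rho> v < e" using assms(1) by (simp add: continuous_pseudonorm_def)
  then show "\<forall>\<^sub>F v in nhds 0. \<forall>x. \<bar>f (v + x) - f x\<bar> < e"
  proof eventually_elim
    case (elim v)
    show ?case using unit_lipschitzD(3)[OF assms(2), of "v + _"] elim
      by (metis add_diff_cancel order_le_less_trans)
  qed
qed

text \<open>
  Uniformity over the whole class of Lipschitz functions, which is not norm compact, is obtained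
  from the pointwise statement for means by minimax and pointwise compactness.
\<close>

lemma approximately_invariant_weights:
  fixes m :: "('a::topological_group_add \<Rightarrow> real) \<Rightarrow> real"
  assumes m: "RUC_mean m" and inv: "\<And>f g. f \<in> RUC_b \<Longrightarrow> m (\<lambda>x. f (g + x)) = m f"
    and \<rho>: "continuous_pseudonorm \<rho>" and E: "finite (E :: 'a set)" and "\<epsilon> > 0"
  shows "\<exists>X w. finite X \<and> (\<forall>x. 0 \<le> w x) \<and> sum w X = 1 \<and>
    (\<forall>f\<in>unit_lipschitz \<rho>. \<forall>g\<in>E. (\<Sum>x\<in>X. w x * (f x - f (g + x))) \<le> \<epsilon>)"
proof (rule ccontr)
  assume neg: "\<not> ?thesis"
  \<comment> \<open>A point \<open>c\<close> of \<open>K\<close> is a family of Lipschitz functions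
    indexed by the group elements. Adding up over \<open>E\<close> lets one function on the group
    record failure for any \<open>g\<close> in \<open>E\<close>.\<close>
  define \<Phi> where "\<Phi> c x = (\<Sum>g\<in>E. c (g, x) - c (g, g + x))" for c :: "'a \<times> 'a \<Rightarrow> real" and x
  define K where "K = {c :: 'a \<times> 'a \<Rightarrow> real. \<forall>p. c p \<in> {0..1}} \<inter> {c. \<forall>g x y. \<bar>c (g, x) - c (g, y)\<bar>
      \<le> \<rho> (x - y)}"
  have K_lip: "(\<lambda>x. c (g, x)) \<in> unit_lipschitz \<rho>" if "c \<in> K" for c g
    using that by (simp add: K_def unit_lipschitz_def)
  have \<rho>_nonneg: "0 \<le> \<rho> x" for x
  proof -
    have "\<rho> (x + - x) \<le> \<rho> x + \<rho> (- x)" "\<rho> 0 = 0" "\<rho> (- x) = \<rho> x"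
      using \<rho> unfolding continuous_pseudonorm_def by blast+
    then show ?thesis by simp
  qed
  have "compact {c :: 'a \<times> 'a \<Rightarrow> real. \<forall>p. c p \<in> {0..1}}"
    by (rule compact_Collect_coordinatewise) simp
  moreover have "closed {c :: 'a \<times> 'a \<Rightarrow> real. \<forall>g x y. \<bar>c (g, x) - c (g, y)\<bar> \<le> \<rho> (x - y)}"
    by (intro closed_Collect_all closed_Collect_le continuous_intros
        continuous_on_product_coordinates)
  ultimately have "compact K" unfolding K_def by (rule compact_Int_closed)
  have "K \<inter> (\<Inter>x\<in>UNIV. {c. \<epsilon> / 2 \<le> \<Phi> c x}) \<noteq> {}"
  proof (rule compact_imp_fip_image[OF \<open>compact K\<close>])
    show "closed {c. \<epsilon> / 2 \<le> \<Phi> c x}" for x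
      unfolding \<Phi>_def
      by (intro closed_Collect_le continuous_intros continuous_on_product_coordinates)
  next
    fix X :: "'a set" assume "finite X"
    \<comment> \<open>By assumption every weight on \<open>X\<close> is refuted by some Lipschitz
      function; minimax turns these refutations into one family that is bad at all points of
      \<open>X\<close> simultaneously.\<close>
    have "\<exists>c\<in>\<Phi> ` K. \<forall>x\<in>X. \<epsilon> - \<epsilon> / 2 \<le> c x"
    proof (rule finite_minimax[OF \<open>finite X\<close>])
      have "(\<lambda>_. 0) \<in> K" by (simp add: K_def \<rho>_nonneg)
      then show "\<Phi> ` K \<noteq> {}" by blast
      show "0 < \<epsilon> / 2" using \<open>\<epsilon> > 0\<close> by simp
    next
      fix c d and t :: real
      assume cd: "c \<in> \<Phi> ` K" "d \<in> \<Phi> ` K" and t: "0 \<le> t" "t \<le> 1"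
      from cd obtain a b where ab: "a \<in> K" "b \<in> K" "c = \<Phi> a" "d = \<Phi> b" by blast
      define h where "h = (\<lambda>p. (1 - t) * a p + t * b p)"
      have "h p \<in> {0..1}" for p
      proof -
        obtain g x where p: "p = (g, x)" by fastforce
        have "0 \<le> a p" "a p \<le> 1" "0 \<le> b p" "b p \<le> 1"
          unfolding p using unit_lipschitzD(1,2)[OF K_lip[OF ab(1)], of g x]
            unit_lipschitzD(1,2)[OF K_lip[OF ab(2)], of g x] by simp_all
        then show ?thesis
          using t convex_bound_le[of "a p" 1 "b p" "1 - t" t] by (simp add: h_def)
      qed
      moreover have "\<bar>h (g, x) - h (g, y)\<bar> \<le> \<rho> (x - y)" for g x y
      proof -
        have "h (g, x) - h (g, y) = (1 - t) * (a (g, x) - a (g, y)) + t * (b (g, x) - b (g, y))"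
          by (simp add: h_def algebra_simps)
        then have "\<bar>h (g, x) - h (g, y)\<bar> \<le> (1 - t) * \<bar>a (g, x) - a (g, y)\<bar> + t * \<bar>b (g, x) - b (g,
            y)\<bar>"
          using t abs_triangle_ineq[of "(1 - t) * (a (g, x) - a (g, y))" "t * (b (g, x) - b (g,
              y))"]
          by (simp add: abs_mult)
        also have "\<dots> \<le> \<rho> (x - y)"
          using unit_lipschitzD(3)[OF K_lip[OF ab(1)], of g x y] unit_lipschitzD(3)[OF K_lip[OF
              ab(2)], of g x y] t
          by (intro convex_bound_le) simp_all
        finally show ?thesis .
      qed
      ultimately have "h \<in> K" by (simp add: K_def)
      moreover have "(\<lambda>x. (1 - t) * c x + t * d x) = \<Phi> h"
      proof
        fix x
        have "\<Phi> h x = (\<Sum>g\<in>E. (1 - t) * (a (g, x) - a (g, g + x)) + t * (b (g, x) - b (g, g + x)))"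
          unfolding \<Phi>_def h_def by (intro sum.cong refl) (simp add: algebra_simps)
        then show "(1 - t) * c x + t * d x = \<Phi> h x"
          by (simp only: ab(3,4) \<Phi>_def sum.distrib sum_distrib_left)
      qed
      ultimately show "(\<lambda>x. (1 - t) * c x + t * d x) \<in> \<Phi> ` K" by blast
    next
      fix c x assume "c \<in> \<Phi> ` K"
      then obtain a where a: "a \<in> K" "c = \<Phi> a" by blast
      have "\<bar>a (g, x) - a (g, g + x)\<bar> \<le> 1" for g
        using unit_lipschitzD(1,2)[OF K_lip[OF a(1)], of g x] unit_lipschitzD(1,2)[OF K_lip[OF
            a(1)], of g "g + x"]
        by linarith
      then have "(\<Sum>g\<in>E. \<bar>a (g, x) - a (g, g + x)\<bar>) \<le> real (card E) * 1"
        by (rule sum_bounded_above)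
      then show "\<bar>c x\<bar> \<le> real (card E)"
        unfolding a(2) \<Phi>_def by (intro order_trans[OF sum_abs]) simp
    next
      fix w :: "'a \<Rightarrow> real" assume w: "\<And>x. 0 \<le> w x" "sum w X = 1"
      have "\<not> (\<forall>f\<in>unit_lipschitz \<rho>. \<forall>g\<in>E. (\<Sum>x\<in>X. w x * (f x - f (g + x))) \<le> \<epsilon>)"
        by (rule notI, rule notE[OF neg], intro exI[of _ X] exI[of _ w] conjI allI w \<open>finite X\<close>)
      then obtain f g where fg: "f \<in> unit_lipschitz \<rho>" "g \<in> E" "\<epsilon> < (\<Sum>x\<in>X. w x * (f x - f (g + x)))"
        by (auto simp: not_le)
      \<comment> \<open>The family concentrated at the single index \<open>g\<close>, so that only
        the refuting function contributes to \<open>\<Phi>\<close>.\<close>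
      define c where "c = (\<lambda>(h, x). if h = g then f x else 0)"
      have "c \<in> K"
        unfolding K_def c_def Int_iff mem_Collect_eq
        by (simp add: unit_lipschitzD[OF fg(1)] \<rho>_nonneg split: prod.split)
      moreover have "\<Phi> c x = f x - f (g + x)" for x
      proof -
        have "\<Phi> c x = (\<Sum>h\<in>E. if h = g then f x - f (g + x) else 0)"
          unfolding \<Phi>_def c_def by (intro sum.cong) auto
        then show ?thesis using E fg(2) by simp
      qed
      ultimately show "\<exists>c\<in>\<Phi> ` K. \<epsilon> \<le> (\<Sum>x\<in>X. w x * c x)"
        using fg(3) by (intro bexI[of _ "\<Phi> c"]) auto
    qed
    then show "K \<inter> (\<Inter>x\<in>X. {c. \<epsilon> / 2 \<le> \<Phi> c x}) \<noteq> {}" by auto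
  qed
  \<comment> \<open>Compactness makes the family independent of \<open>X\<close>. Its
    \<open>\<Phi> c\<close> is at least \<open>\<epsilon> / 2\<close> on the whole group, yet the
    invariant mean annihilates it.\<close>
  then obtain c where c: "c \<in> K" "\<And>x. \<epsilon> / 2 \<le> \<Phi> c x" by blast
  define f where "f g = (\<lambda>x. c (g, x))" for g
  have f: "f g \<in> RUC_b" for g
    unfolding f_def by (rule unit_lipschitz_RUC_b[OF \<rho> K_lip[OF c(1)]])
  note f' = RUC_b_translate[OF f]
  have "\<Phi> c = (\<lambda>x. \<Sum>g\<in>E. f g x - f g (g + x))" by (simp add: fun_eq_iff \<Phi>_def f_def)
  then have "m (\<Phi> c) = (\<Sum>g\<in>E. m (\<lambda>x. f g x - f g (g + x)))" "\<Phi> c \<in> RUC_b"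
    using RUC_mean_sum[OF m, of E "\<lambda>g x. f g x - f g (g + x)"] RUC_b_sum[of E "\<lambda>g x. f g x - f g
        (g + x)"]
    by (simp_all add: RUC_b_diff[OF f f'])
  moreover have "m (\<lambda>x. f g x - f g (g + x)) = 0" for g
    by (simp add: RUC_mean_diff[OF m f f'] inv[OF f])
  ultimately have "m (\<Phi> c) = 0" "\<Phi> c \<in> RUC_b" by simp_all
  moreover from this have "m (\<lambda>_. \<epsilon> / 2) \<le> m (\<Phi> c)" by (intro RUC_mean_mono[OF m RUC_b_const])
      (simp_all only: c(2))
  ultimately show False using \<open>\<epsilon> > 0\<close> by (simp add: RUC_mean_const[OF m])
qed

lemma approximately_invariant_multiplicities:
  fixes m :: "('a::topological_group_add \<Rightarrow> real) \<Rightarrow> real"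
  assumes m: "RUC_mean m" and inv: "\<And>f g. f \<in> RUC_b \<Longrightarrow> m (\<lambda>x. f (g + x)) = m f"
    and \<rho>: "continuous_pseudonorm \<rho>" and E: "finite (E :: 'a set)" and "(\<epsilon> :: real) > 0"
  shows "\<exists>X (n :: 'a \<Rightarrow> nat). finite X \<and> 0 < sum n X \<and>
    (\<forall>f\<in>unit_lipschitz \<rho>. \<forall>g\<in>E. (\<Sum>x\<in>X. real (n x) * (f x - f (g + x))) \<le> \<epsilon> * real (sum n X))"
proof -
  have half: "0 < \<epsilon> / 2" using \<open>\<epsilon> > 0\<close> by simp
  obtain X w where X: "finite X" and w: "\<And>x. 0 \<le> w x" "sum w X = 1"
    and wE: "\<And>f g. f \<in> unit_lipschitz \<rho> \<Longrightarrow> g \<in> E \<Longrightarrow> (\<Sum>x\<in>X. w x * (f x - f (g + x))) \<le> \<epsilon> / 2"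
    using approximately_invariant_weights[OF m inv \<rho> E half] by blast
  have "X \<noteq> {}" using w(2) by auto
  then have cX: "0 < real (card X)" using X by (simp add: card_gt_0_iff)
  \<comment> \<open>Rounding costs at most 1 per point of \<open>X\<close>, both in the sum and in
    the total mass; this \<open>K\<close> solves
    \<open>K * \<epsilon> / 2 + card X = \<epsilon> * (K - card X)\<close>.\<close>
  define K where "K = 2 * real (card X) * (1 + \<epsilon>) / \<epsilon>"
  have K: "\<epsilon> * K = 2 * real (card X) * (1 + \<epsilon>)" using \<open>\<epsilon> > 0\<close> by (simp add: K_def)
  have "0 < K" using \<open>\<epsilon> > 0\<close> cX by (simp add: K_def)
  define n where "n x = nat \<lfloor>K * w x\<rfloor>" for x
  have n: "\<bar>real (n x) - K * w x\<bar> \<le> 1" for x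
  proof -
    have "0 \<le> \<lfloor>K * w x\<rfloor>" using \<open>0 < K\<close> w(1) by simp
    then have "real (n x) = of_int \<lfloor>K * w x\<rfloor>" by (simp add: n_def)
    then show ?thesis by linarith
  qed
  have "K - real (card X) = (\<Sum>x\<in>X. K * w x - 1)"
    using w(2) by (simp add: sum_subtractf flip: sum_distrib_left)
  also have "\<dots> \<le> (\<Sum>x\<in>X. real (n x))" by (intro sum_mono) (use n in \<open>simp add: abs_le_iff
      algebra_simps\<close>)
  finally have N: "K - real (card X) \<le> real (sum n X)" by simp
  have "\<epsilon> * K > \<epsilon> * real (card X)" unfolding K using cX \<open>\<epsilon> > 0\<close> by (simp add: algebra_simps
      add_pos_pos)
  then have "real (card X) < K" using \<open>\<epsilon> > 0\<close> by simp
  with N have "0 < real (sum n X)" by linarith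
  then have "0 < sum n X" by (simp only: of_nat_0_less_iff)
  moreover have "(\<Sum>x\<in>X. real (n x) * (f x - f (g + x))) \<le> \<epsilon> * real (sum n X)"
    if f: "f \<in> unit_lipschitz \<rho>" and g: "g \<in> E" for f :: "'a \<Rightarrow> real" and g
  proof -
    have "(\<Sum>x\<in>X. real (n x) * (f x - f (g + x))) \<le> (\<Sum>x\<in>X. K * (w x * (f x - f (g + x))) + 1)"
    proof (rule sum_mono)
      fix x
      have "\<bar>f x - f (g + x)\<bar> \<le> 1"
        using unit_lipschitzD(1,2)[OF f, of x] unit_lipschitzD(1,2)[OF f, of "g + x"] by linarith
      then have "\<bar>real (n x) - K * w x\<bar> * \<bar>f x - f (g + x)\<bar> \<le> 1 * 1"
        using n by (intro mult_mono) auto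
      then have "(real (n x) - K * w x) * (f x - f (g + x)) \<le> 1"
        by (simp flip: abs_mult)
      then show "real (n x) * (f x - f (g + x)) \<le> K * (w x * (f x - f (g + x))) + 1"
        by (simp add: algebra_simps)
    qed
    also have "\<dots> = K * (\<Sum>x\<in>X. w x * (f x - f (g + x))) + real (card X)"
      by (simp add: sum.distrib sum_distrib_left)
    also have "\<dots> \<le> K * (\<epsilon> / 2) + real (card X)"
      using \<open>0 < K\<close> wE[OF f g] by simp
    also have "\<dots> \<le> \<epsilon> * (K - real (card X))"
      using K cX by (simp add: algebra_simps)
    also have "\<dots> \<le> \<epsilon> * real (sum n X)"
      using N \<open>\<epsilon> > 0\<close> by (intro mult_left_mono) auto
    finally show ?thesis .
  qed
  ultimately show ?thesis using X by blast
qed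

section \<open>From multisets to sets\<close>

lemma infinite_distinct_representatives:
  assumes "finite I" "\<And>i. i \<in> I \<Longrightarrow> infinite (A i)"
  shows "\<exists>y. inj_on y I \<and> (\<forall>i\<in>I. y i \<in> A i)"
  using assms
proof (induction I)
  case (insert i I)
  then obtain y where y: "inj_on y I" "\<forall>i\<in>I. y i \<in> A i" by auto
  have "infinite (A i - y ` I)" using insert by (simp add: Diff_infinite_finite)
  then obtain z where z: "z \<in> A i" "z \<notin> y ` I" using infinite_imp_nonempty by blast
  have "inj_on (y(i := z)) (insert i I)"
    using y(1) z(2) insert.hyps(2) by (auto simp: inj_on_def)
  moreover have "\<forall>j\<in>insert i I. (y(i := z)) j \<in> A j" using y(2) z(1) by auto
  ultimately show ?case by blast
qed simp

text \<open>For this pseudonorm every function with values in \<open>[0, 1]\<close> is 1-Lipschitz,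
  so almost invariance holds in total variation.\<close>

lemma discrete_pseudonorm:
  assumes "open {0 :: 'a::topological_group_add}"
  shows "continuous_pseudonorm (\<lambda>x::'a. if x = 0 then 0 else 1)"
proof -
  have "\<forall>\<^sub>F v in nhds (0::'a). v = 0" using assms by (auto simp: eventually_nhds)
  then have "\<forall>\<^sub>F v in nhds (0::'a). (if v = 0 then 0 else 1) < e" if "e > 0" for e :: real
    by eventually_elim (use that in auto)
  then show ?thesis by (auto simp: continuous_pseudonorm_def)
qed

text \<open>
  A multiset can be perturbed to a set unless the group is discrete, in which case some level set
  of the multiset will do.
\<close>

lemma folner_set_nondiscrete:
  fixes m :: "('a::{topological_group_add, t2_space} \<Rightarrow> real) \<Rightarrow> real"
  assumes m: "RUC_mean m" and inv: "\<And>f g. f \<in> RUC_b \<Longrightarrow> m (\<lambda>x. f (g + x)) = m f"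
    and \<rho>: "continuous_pseudonorm \<rho>" and E: "finite (E :: 'a set)" and "(\<epsilon> :: real) > 0"
    and nd: "\<not> open {0 :: 'a}"
  shows "\<exists>F. finite F \<and> F \<noteq> {} \<and>
    (\<forall>f\<in>unit_lipschitz \<rho>. \<forall>g\<in>E. (\<Sum>x\<in>F. f x - f (g + x)) \<le> \<epsilon> * real (card F))"
proof -
  have half: "0 < \<epsilon> / 2" using \<open>\<epsilon> > 0\<close> by simp
  obtain X and n :: "'a \<Rightarrow> nat" where X: "finite X" "0 < sum n X"
    and nE: "\<And>f g. f \<in> unit_lipschitz \<rho> \<Longrightarrow> g \<in> E \<Longrightarrow>
      (\<Sum>x\<in>X. real (n x) * (f x - f (g + x))) \<le> \<epsilon> / 2 * real (sum n X)"
    using approximately_invariant_multiplicities[OF m inv \<rho> E half] by blast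
  \<comment> \<open>Moving \<open>x\<close> to \<open>v + x\<close> moves \<open>g + x\<close> by
    the conjugate \<open>g + v - g\<close>, so both displacements must be small. Together they cost
    \<open>\<epsilon> / 2\<close> per point.\<close>
  define W where "W = {v. \<rho> v < \<epsilon> / 4 \<and> (\<forall>g\<in>E. \<rho> (g + v - g) < \<epsilon> / 4)}"
  have \<rho>_small: "\<forall>\<^sub>F v in nhds 0. \<rho> v < \<epsilon> / 4"
    using \<rho> divide_pos_pos[OF \<open>\<epsilon> > 0\<close> zero_less_numeral] unfolding continuous_pseudonorm_def by
        blast
  have "\<forall>\<^sub>F v in nhds 0. \<rho> (g + v - g) < \<epsilon> / 4" for g
    by (rule eventually_compose_filterlim[OF \<rho>_small tendsto_conjugate])
  then have "\<forall>\<^sub>F v in nhds 0. v \<in> W"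
    unfolding W_def mem_Collect_eq using \<rho>_small E by (intro eventually_conj
        eventually_ball_finite) auto
  then obtain S where S: "open S" "0 \<in> S" "S \<subseteq> W" unfolding eventually_nhds by blast
  \<comment> \<open>In a nondiscrete Hausdorff group every neighbourhood of the neutral element is
    infinite, which leaves room to separate all copies.\<close>
  have "(0::'a) islimpt UNIV" using nd by (simp add: islimpt_UNIV_iff)
  then have "infinite S" using S(1,2) by (auto simp: islimpt_eq_acc_point)
  then have "infinite W" using S(3) finite_subset by blast
  define I where "I = Sigma X (\<lambda>x. {..<n x})"
  have I: "finite I" "card I = sum n X" using X(1) by (simp_all add: I_def)
  have "infinite ((\<lambda>v. v + fst i) ` W)" for i :: "'a \<times> nat"
  proof -
    have "inj_on (\<lambda>v. v + fst i) W" by (simp add: inj_on_def)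
    with \<open>infinite W\<close> show ?thesis using finite_imageD by blast
  qed
  from infinite_distinct_representatives[OF I(1), of "\<lambda>i. (\<lambda>v. v + fst i) ` W", OF this]
  obtain y where y: "inj_on y I" "\<forall>i\<in>I. y i \<in> (\<lambda>v. v + fst i) ` W" by (elim exE conjE)
  define F where "F = y ` I"
  have F: "finite F" "card F = sum n X" using I y(1) by (simp_all add: F_def card_image)
  moreover have "F \<noteq> {}" using X(2) F(2) by auto
  moreover have "(\<Sum>x\<in>F. f x - f (g + x)) \<le> \<epsilon> * real (card F)"
    if f: "f \<in> unit_lipschitz \<rho>" and g: "g \<in> E" for f :: "'a \<Rightarrow> real" and g
  proof -
    have "(\<Sum>x\<in>F. f x - f (g + x)) = (\<Sum>i\<in>I. f (y i) - f (g + y i))"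
      using y(1) by (simp add: F_def sum.reindex)
    also have "\<dots> \<le> (\<Sum>i\<in>I. (f (fst i) - f (g + fst i)) + \<epsilon> / 2)"
    proof (rule sum_mono)
      fix i assume "i \<in> I"
      then have "y i \<in> (\<lambda>v. v + fst i) ` W" using y(2) by simp
      then obtain v where v: "v \<in> W" "y i = v + fst i" by (elim imageE)
      have "\<bar>f (y i) - f (fst i)\<bar> \<le> \<rho> v"
        using unit_lipschitzD(3)[OF f, of "y i" "fst i"] v(2) by simp
      moreover have "\<bar>f (g + y i) - f (g + fst i)\<bar> \<le> \<rho> (g + v - g)"
      proof -
        have "(g + y i) - (g + fst i) = g + v - g"
          by (simp add: v(2) diff_conv_add_uminus minus_add add.assoc del: add_uminus_conv_diff)
        then show ?thesis using unit_lipschitzD(3)[OF f, of "g + y i" "g + fst i"] by simp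
      qed
      moreover have "\<rho> v < \<epsilon> / 4" "\<rho> (g + v - g) < \<epsilon> / 4" using v(1) g by (auto simp: W_def)
      ultimately show "f (y i) - f (g + y i) \<le> (f (fst i) - f (g + fst i)) + \<epsilon> / 2" by linarith
    qed
    also have "\<dots> = (\<Sum>i\<in>I. f (fst i) - f (g + fst i)) + \<epsilon> / 2 * real (sum n X)"
      by (simp add: sum.distrib I)
    also have "(\<Sum>i\<in>I. f (fst i) - f (g + fst i)) = (\<Sum>x\<in>X. real (n x) * (f x - f (g + x)))"
    proof -
      have "(\<Sum>x\<in>X. \<Sum>j<n x. f x - f (g + x)) = (\<Sum>(x, j)\<in>I. f x - f (g + x))"
        unfolding I_def by (rule sum.Sigma) (use X(1) in auto)
      then show ?thesis by (simp add: case_prod_unfold)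
    qed
    also have "\<dots> + \<epsilon> / 2 * real (sum n X) \<le> \<epsilon> / 2 * real (sum n X) + \<epsilon> / 2 * real (sum n X)"
      using nE[OF f g] by simp
    finally show ?thesis by (simp add: F(2) field_simps)
  qed
  ultimately show ?thesis by blast
qed

text \<open>Layer-cake argument: summed over the levels, the boundaries of the level sets give the
  positive part of \<open>n\<close> minus its translate, which a single test function measures. On
  average over the levels the boundaries are small, hence for some level.\<close>

lemma folner_set_discrete:
  fixes m :: "('a::topological_group_add \<Rightarrow> real) \<Rightarrow> real"
  assumes m: "RUC_mean m" and inv: "\<And>f g. f \<in> RUC_b \<Longrightarrow> m (\<lambda>x. f (g + x)) = m f"
    and E: "finite (E :: 'a set)" and "(\<epsilon> :: real) > 0" and discrete: "open {0 :: 'a}"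
  shows "\<exists>F. finite F \<and> F \<noteq> {} \<and>
    (\<forall>f\<in>unit_lipschitz \<rho>. \<forall>g\<in>E. (\<Sum>x\<in>F. f x - f (g + x)) \<le> \<epsilon> * real (card F))"
proof -
  \<comment> \<open>One level set must serve all of \<open>E\<close>, so the boundaries are summed
    over \<open>E\<close>; the added 1 keeps \<open>\<delta> * card E\<close> strictly below
    \<open>\<epsilon>\<close>, also for empty \<open>E\<close>.\<close>
  define \<delta> where "\<delta> = \<epsilon> / (real (card E) + 1)"
  have "\<delta> > 0" using \<open>\<epsilon> > 0\<close> by (simp add: \<delta>_def)
  obtain X and n0 :: "'a \<Rightarrow> nat" where X: "finite X" "0 < sum n0 X"
    and n0: "\<And>f g. f \<in> unit_lipschitz (\<lambda>x. if x = 0 then 0 else 1) \<Longrightarrow> g \<in> E \<Longrightarrow>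
      (\<Sum>x\<in>X. real (n0 x) * (f x - f (g + x))) \<le> \<delta> * real (sum n0 X)"
    using approximately_invariant_multiplicities[OF m inv discrete_pseudonorm[OF discrete] E \<open>\<delta> >
        0\<close>] by blast
  define n where "n x = (if x \<in> X then n0 x else 0)" for x
  define N where "N = sum n X"
  have N: "N = sum n0 X" by (simp add: N_def n_def)
  define L where "L j = {x \<in> X. j < n x}" for j
  have finL: "finite (L j)" for j using X(1) by (simp add: L_def)
  have n_le: "n x \<le> N" for x
    using X(1) by (cases "x \<in> X") (auto simp: N_def n_def intro: member_le_sum)
  have layers: "(\<Sum>j<N. card (L j)) = N"
  proof -
    have "(\<Sum>j<N. card (L j)) = (\<Sum>j<N. \<Sum>x\<in>X. if j < n x then 1 else 0)"
      using X(1) by (simp add: L_def sum.If_cases Int_def)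
    also have "\<dots> = (\<Sum>x\<in>X. \<Sum>j<N. if j < n x then 1 else 0)" by (rule sum.swap)
    also have "\<dots> = (\<Sum>x\<in>X. n x)"
    proof (rule sum.cong)
      fix x
      have "{..<N} \<inter> {j. j < n x} = {..<n x}" using n_le[of x] by auto
      then show "(\<Sum>j<N. if j < n x then 1 else 0) = n x" by (simp add: sum.If_cases)
    qed simp
    finally show ?thesis by (simp add: N_def)
  qed
  have boundary: "(\<Sum>j<N. real (card (L j - (\<lambda>x. g + x) ` L j))) \<le> \<delta> * real N" if g: "g \<in> E" for g
  proof -
    have mem: "x \<in> (\<lambda>x. g + x) ` L j \<longleftrightarrow> j < n (- g + x)" for x j
    proof
      assume "x \<in> (\<lambda>x. g + x) ` L j"
      then show "j < n (- g + x)" by (auto simp: L_def add.assoc[symmetric])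
    next
      assume "j < n (- g + x)"
      then have "- g + x \<in> L j" by (auto simp: L_def n_def split: if_splits)
      moreover have "x = g + (- g + x)" by (simp add: add.assoc[symmetric])
      ultimately show "x \<in> (\<lambda>x. g + x) ` L j" by blast
    qed
    \<comment> \<open>The indicator of the points where \<open>n\<close> exceeds its translate, so
      that multiplying the difference by \<open>f\<close> leaves its positive part.\<close>
    define f :: "'a \<Rightarrow> real" where "f x = (if n (- g + x) < n x then 1 else 0)" for x
    have f: "f \<in> unit_lipschitz (\<lambda>x. if x = 0 then 0 else 1)"
      by (auto simp: unit_lipschitz_def f_def)
    have "(\<Sum>j<N. real (card (L j - (\<lambda>x. g + x) ` L j)))
        = (\<Sum>j<N. \<Sum>x\<in>X. if n (- g + x) \<le> j \<and> j < n x then 1 else 0)"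
    proof (intro sum.cong refl)
      fix j
      have "L j - (\<lambda>x. g + x) ` L j = X \<inter> {x. n (- g + x) \<le> j \<and> j < n x}"
        using mem by (auto simp: L_def not_less)
      then show "real (card (L j - (\<lambda>x. g + x) ` L j)) = (\<Sum>x\<in>X. if n (- g + x) \<le> j \<and> j < n x then
          1 else 0)"
        using X(1) by (simp add: sum.If_cases)
    qed
    also have "\<dots> = (\<Sum>x\<in>X. \<Sum>j<N. if n (- g + x) \<le> j \<and> j < n x then 1 else 0)"
      by (rule sum.swap)
    also have "\<dots> = (\<Sum>x\<in>X. real (n x - n (- g + x)))"
    proof (intro sum.cong refl)
      fix x
      have "{..<N} \<inter> {j. n (- g + x) \<le> j \<and> j < n x} = {n (- g + x)..<n x}"
        using n_le[of x] by auto
      then show "(\<Sum>j<N. if n (- g + x) \<le> j \<and> j < n x then 1 else 0) = real (n x - n (- g + x))"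
        by (simp add: sum.If_cases)
    qed
    also have "\<dots> = (\<Sum>x\<in>X. real (n x) * f x) - (\<Sum>x\<in>X. real (n (- g + x)) * f x)"
      unfolding sum_subtractf[symmetric] by (intro sum.cong refl) (auto simp: f_def of_nat_diff)
    also have "(\<Sum>x\<in>X. real (n (- g + x)) * f x) = (\<Sum>x\<in>X. real (n x) * f (g + x))"
    proof -
      have pos: "x \<in> X" if "f x \<noteq> 0" for x
        using that by (auto simp: f_def n_def split: if_splits)
      have pos': "x \<in> X" if "n x \<noteq> 0" for x using that by (auto simp: n_def split: if_splits)
      \<comment> \<open>Both sides extend to the union of \<open>X\<close> and its translate:
        \<open>f\<close> vanishes off \<open>X\<close>, and \<open>n (- g + x)\<close> vanishes off
        the translate.\<close>
      have "(\<Sum>x\<in>X. real (n (- g + x)) * f x) = (\<Sum>x\<in>X \<union> (\<lambda>x. g + x) ` X. real (n (- g + x)) * f x)"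
        using X(1) pos by (intro sum.mono_neutral_left) auto
      also have "\<dots> = (\<Sum>x\<in>(\<lambda>x. g + x) ` X. real (n (- g + x)) * f x)"
      proof (intro sum.mono_neutral_right ballI)
        fix x assume x: "x \<in> X \<union> (\<lambda>x. g + x) ` X - (\<lambda>x. g + x) ` X"
        have "x = g + (- g + x)" by (simp add: add.assoc[symmetric])
        with x have "- g + x \<notin> X" by blast
        then show "real (n (- g + x)) * f x = 0" using pos' by force
      qed (use X(1) in auto)
      also have "\<dots> = (\<Sum>x\<in>X. real (n x) * f (g + x))"
        by (simp add: sum.reindex add.assoc[symmetric])
      finally show ?thesis .
    qed
    also have "(\<Sum>x\<in>X. real (n x) * f x) - (\<Sum>x\<in>X. real (n x) * f (g + x)) = (\<Sum>x\<in>X. real (n0 x) * (f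
        x - f (g + x)))"
      by (simp add: n_def sum_subtractf right_diff_distrib)
    also have "\<dots> \<le> \<delta> * real N" using n0[OF f g] N by simp
    finally show ?thesis .
  qed
  have "\<exists>j. L j \<noteq> {} \<and> (\<Sum>g\<in>E. real (card (L j - (\<lambda>x. g + x) ` L j))) \<le> \<epsilon> * real (card (L j))"
  proof (rule ccontr)
    assume neg: "\<nexists>j. L j \<noteq> {} \<and> (\<Sum>g\<in>E. real (card (L j - (\<lambda>x. g + x) ` L j))) \<le> \<epsilon> * real (card (L
        j))"
    have "\<epsilon> * real (card (L j)) \<le> (\<Sum>g\<in>E. real (card (L j - (\<lambda>x. g + x) ` L j)))" for j
    proof (cases "L j = {}")
      case False
      then show ?thesis using neg by (meson less_imp_le not_le)
    qed simp
    then have "(\<Sum>j<N. \<epsilon> * real (card (L j))) \<le> (\<Sum>j<N. \<Sum>g\<in>E. real (card (L j - (\<lambda>x. g + x) ` L j)))"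
      by (rule sum_mono)
    also have "\<dots> = (\<Sum>g\<in>E. \<Sum>j<N. real (card (L j - (\<lambda>x. g + x) ` L j)))" by (rule sum.swap)
    also have "\<dots> \<le> (\<Sum>g\<in>E. \<delta> * real N)" by (rule sum_mono[OF boundary])
    also have "\<dots> = \<delta> * real (card E) * real N" by simp
    also have "(\<Sum>j<N. \<epsilon> * real (card (L j))) = \<epsilon> * real N"
      using layers by (simp flip: sum_distrib_left of_nat_sum)
    finally have "\<epsilon> * real N \<le> \<delta> * real (card E) * real N" .
    moreover have "0 < real N" using X(2) N by (simp only: of_nat_0_less_iff)
    ultimately have "\<epsilon> \<le> \<delta> * real (card E)" by (rule mult_right_le_imp_le)
    also have "\<delta> * real (card E) < \<epsilon>" using \<open>\<epsilon> > 0\<close> by (simp add: \<delta>_def field_simps)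
    finally show False by simp
  qed
  then obtain j where j: "L j \<noteq> {}" "(\<Sum>g\<in>E. real (card (L j - (\<lambda>x. g + x) ` L j))) \<le> \<epsilon> * real
      (card (L j))"
    by blast
  have "(\<Sum>x\<in>L j. f x - f (g + x)) \<le> \<epsilon> * real (card (L j))" if f: "f \<in> unit_lipschitz \<rho>" and g: "g
      \<in> E" for f :: "'a \<Rightarrow> real" and g
  proof -
    let ?G = "(\<lambda>x. g + x) ` L j"
    \<comment> \<open>The sum over the common part is absorbed by the sum over \<open>?G\<close>,
      and each boundary point contributes at most 1.\<close>
    have "(\<Sum>x\<in>L j. f x - f (g + x)) = (\<Sum>x\<in>L j. f x) - (\<Sum>x\<in>?G. f x)"
      by (simp add: sum_subtractf sum.reindex)
    also have "(\<Sum>x\<in>L j. f x) = (\<Sum>x\<in>L j - ?G. f x) + (\<Sum>x\<in>L j \<inter> ?G. f x)"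
      using sum.Int_Diff[OF finL[of j], of f ?G] by simp
    also have "(\<Sum>x\<in>L j \<inter> ?G. f x) \<le> (\<Sum>x\<in>?G. f x)"
      using finL[of j] unit_lipschitzD(1)[OF f] by (intro sum_mono2) auto
    also have "(\<Sum>x\<in>L j - ?G. f x) \<le> (\<Sum>x\<in>L j - ?G. 1)"
      using unit_lipschitzD(2)[OF f] by (intro sum_mono)
    also have "\<dots> = real (card (L j - ?G))" by simp
    also have "\<dots> \<le> (\<Sum>g\<in>E. real (card (L j - (\<lambda>x. g + x) ` L j)))"
      using E g by (intro member_le_sum[of g E "\<lambda>g. real (card (L j - (\<lambda>x. g + x) ` L j))"]) auto
    also note j(2)
    finally show ?thesis by simp
  qed
  then show ?thesis using finL j(1) by blast
qed

section \<open>From almost invariant sets to matchings\<close>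

lemma matching_number_folner:
  fixes \<rho> :: "'a::topological_group_add \<Rightarrow> real"
  assumes \<rho>: "continuous_pseudonorm \<rho>" and U: "\<And>x. \<rho> x < 1 \<Longrightarrow> x \<in> U" and F: "finite F"
    and almost_inv: "\<And>f. f \<in> unit_lipschitz \<rho> \<Longrightarrow> (\<Sum>x\<in>F. f x - f (g + x)) \<le> \<epsilon> * real (card F)"
    and "0 \<le> (\<epsilon> :: real)"
  shows "(1 - \<epsilon>) * real (card F) \<le> real (matching_number F ((\<lambda>x. g + x) ` F) U)"
proof -
  have \<rho>0: "\<rho> 0 = 0" and \<rho>_uminus: "\<And>x. \<rho> (- x) = \<rho> x"
    and \<rho>_add: "\<And>x y. \<rho> (x + y) \<le> \<rho> x + \<rho> y"
    using \<rho> by (auto simp: continuous_pseudonorm_def)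
  have \<rho>_nonneg: "0 \<le> \<rho> x" for x using \<rho>_add[of x "- x"] \<rho>_uminus[of x] \<rho>0 by simp
  define A where "A x = {y \<in> (\<lambda>x. g + x) ` F. y - x \<in> U}" for x
  \<comment> \<open>Hall's condition compares integers, so the real defect may be rounded
    down.\<close>
  define d where "d = nat \<lfloor>\<epsilon> * real (card F)\<rfloor>"
  have "\<exists>K R. K \<subseteq> F \<and> card F \<le> card K + d \<and> inj_on R K \<and> (\<forall>x\<in>K. R x \<in> A x)"
  proof (rule hall_defect[OF F])
    show "finite (A x)" for x using F by (simp add: A_def)
    fix J assume J: "J \<subseteq> F"
    show "card J \<le> card (\<Union> (A ` J)) + d"
    proof (cases "J = {}")
      case False
      have finJ: "finite J" using J F finite_subset by blast
      define f where "f x = max 0 (Max ((\<lambda>s. 1 - \<rho> (x - s)) ` J))" for x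
      have f_ge: "1 - \<rho> (x - s) \<le> f x" if "s \<in> J" for x s
      proof -
        have "1 - \<rho> (x - s) \<le> Max ((\<lambda>s. 1 - \<rho> (x - s)) ` J)"
          using that finJ by (intro Max_ge) auto
        then show ?thesis by (simp add: f_def)
      qed
      have f_nonneg: "0 \<le> f x" for x by (simp add: f_def)
      have f_attained: "f x = 0 \<or> (\<exists>s\<in>J. f x = 1 - \<rho> (x - s))" for x
      proof -
        have "Max ((\<lambda>s. 1 - \<rho> (x - s)) ` J) \<in> (\<lambda>s. 1 - \<rho> (x - s)) ` J"
          using finJ False by (intro Max_in) auto
        then show ?thesis by (auto simp: f_def max_def)
      qed
      have f_le: "f x \<le> f y + \<rho> (x - y)" for x y
      proof -
        have "1 - \<rho> (x - s) \<le> f y + \<rho> (x - y)" if "s \<in> J" for s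
        proof -
          have "\<rho> (y - s) = \<rho> ((y - x) + (x - s))"
            by (simp add: diff_conv_add_uminus add.assoc del: add_uminus_conv_diff)
          also have "\<dots> \<le> \<rho> (y - x) + \<rho> (x - s)" by (rule \<rho>_add)
          also have "\<rho> (y - x) = \<rho> (x - y)" using \<rho>_uminus[of "x - y"] by simp
          finally show ?thesis using f_ge[OF that, of y] by simp
        qed
        then show ?thesis using f_attained[of x] f_nonneg[of y] \<rho>_nonneg[of "x - y"] by auto
      qed
      have f: "f \<in> unit_lipschitz \<rho>"
        unfolding unit_lipschitz_def
      proof (intro CollectI conjI allI)
        fix x y
        show "0 \<le> f x" by (rule f_nonneg)
        show "f x \<le> 1" using f_attained[of x] \<rho>_nonneg by force
        have "\<rho> (y - x) = \<rho> (x - y)" using \<rho>_uminus[of "x - y"] by simp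
        then show "\<bar>f x - f y\<bar> \<le> \<rho> (x - y)" using f_le[of x y] f_le[of y x] by linarith
      qed
      have f_one: "1 \<le> f s" if "s \<in> J" for s using f_ge[OF that, of s] \<rho>0 by simp
      \<comment> \<open>\<open>f\<close> is at least 1 on \<open>J\<close>; passing from
        \<open>F\<close> to its translate costs \<open>\<epsilon> * card F\<close>; there
        \<open>f\<close> is supported on the neighbours of \<open>J\<close> and is at most
        1.\<close>
      have "real (card J) = (\<Sum>s\<in>J. 1)" by simp
      also have "\<dots> \<le> (\<Sum>s\<in>J. f s)" by (rule sum_mono[OF f_one])
      also have "\<dots> \<le> (\<Sum>x\<in>F. f x)" using F J f_nonneg by (intro sum_mono2) auto
      also have "\<dots> \<le> (\<Sum>x\<in>F. f (g + x)) + \<epsilon> * real (card F)"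
        using almost_inv[OF f] by (simp add: sum_subtractf)
      also have "(\<Sum>x\<in>F. f (g + x)) = (\<Sum>y\<in>(\<lambda>x. g + x) ` F. f y)"
        by (simp add: sum.reindex)
      also have "\<dots> = (\<Sum>y\<in>\<Union> (A ` J). f y)"
      proof (rule sum.mono_neutral_right)
        show "\<forall>y\<in>(\<lambda>x. g + x) ` F - \<Union> (A ` J). f y = 0"
        proof
          fix y assume y: "y \<in> (\<lambda>x. g + x) ` F - \<Union> (A ` J)"
          \<comment> \<open>A point of the translate that is not adjacent to \<open>s\<close> has
            distance at least 1 from \<open>s\<close>, by the choice of
            \<open>\<rho>\<close>.\<close>
          have "f y = 1 - \<rho> (y - s) \<Longrightarrow> s \<in> J \<Longrightarrow> 1 \<le> \<rho> (y - s)" for s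
            using y U[of "y - s"] by (force simp: A_def)
          then show "f y = 0" using f_attained[of y] f_nonneg[of y] by force
        qed
      qed (use F in \<open>auto simp: A_def\<close>)
      also have "\<dots> \<le> (\<Sum>y\<in>\<Union> (A ` J). 1)" by (rule sum_mono[OF unit_lipschitzD(2)[OF f]])
      also have "\<dots> = real (card (\<Union> (A ` J)))" by simp
      finally have "real (card J) - real (card (\<Union> (A ` J))) \<le> \<epsilon> * real (card F)" by simp
      then have "int (card J) - int (card (\<Union> (A ` J))) \<le> \<lfloor>\<epsilon> * real (card F)\<rfloor>"
        by (simp add: le_floor_iff)
      then show ?thesis by (simp add: d_def)
    qed simp
  qed
  then obtain K R where K: "K \<subseteq> F" "card F \<le> card K + d" "inj_on R K" "\<And>x. x \<in> K \<Longrightarrow> R x \<in> A x"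
    by blast
  have "card K \<le> matching_number F ((\<lambda>x. g + x) ` F) U"
    unfolding matching_number_ge_iff[OF F]
    using K by (intro exI[of _ K] exI[of _ R]) (auto simp: A_def)
  moreover have "real d \<le> \<epsilon> * real (card F)" using \<open>0 \<le> \<epsilon>\<close> by (simp add: d_def)
  ultimately show ?thesis using K(2) by (simp add: algebra_simps)
qed

proposition matchings_of_amenable:
  fixes E :: "'a::{topological_group_add, t2_space} set"
  assumes "amenable TYPE('a)" and "\<theta> < 1" and E: "finite E" and U: "U \<in> nbhds_neutral"
  shows "\<exists>F. finite F \<and> F \<noteq> {} \<and>
    (\<forall>g\<in>E. \<theta> * real (card F) \<le> real (matching_number F ((\<lambda>x. g + x) ` F) U))"
proof -
  obtain m :: "('a \<Rightarrow> real) \<Rightarrow> real" where m: "RUC_mean m"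
    and inv: "\<And>f g. f \<in> RUC_b \<Longrightarrow> m (\<lambda>x. f (g + x)) = m f"
    using assms(1) unfolding amenable_iff_RUC_mean by blast
  obtain \<rho> where \<rho>: "continuous_pseudonorm \<rho>" "\<And>x. \<rho> x < 1 \<Longrightarrow> x \<in> U"
    using continuous_pseudonorm_exists[OF U] by blast
  have "0 < 1 - \<theta>" using \<open>\<theta> < 1\<close> by simp
  \<comment> \<open>A defect of at most \<open>(1 - \<theta>) * card F\<close> leaves
    \<open>\<theta> * card F\<close> matched points.\<close>
  have "\<exists>F. finite F \<and> F \<noteq> {} \<and>
      (\<forall>f\<in>unit_lipschitz \<rho>. \<forall>g\<in>E. (\<Sum>x\<in>F. f x - f (g + x)) \<le> (1 - \<theta>) * real (card F))"
    using folner_set_discrete[OF m inv E \<open>0 < 1 - \<theta>\<close>]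
      folner_set_nondiscrete[OF m inv \<rho>(1) E \<open>0 < 1 - \<theta>\<close>]
    by (cases "open {0 :: 'a}")
  then obtain F where F: "finite F" "F \<noteq> {}"
    "\<And>f g. f \<in> unit_lipschitz \<rho> \<Longrightarrow> g \<in> E \<Longrightarrow> (\<Sum>x\<in>F. f x - f (g + x)) \<le> (1 - \<theta>) * real (card F)"
    by blast
  have "\<theta> * real (card F) \<le> real (matching_number F ((\<lambda>x. g + x) ` F) U)" if "g \<in> E" for g
    using matching_number_folner[OF \<rho> F(1) F(3)[OF _ that]] \<open>0 < 1 - \<theta>\<close> by simp
  with F(1,2) show ?thesis by blast
qed

theorem theorem4p5:
  shows "(amenable TYPE('a::{topological_group_add, t2_space}) \<longleftrightarrow>
      (\<forall>\<theta>\<in>{0<..<1::real}. \<forall>E :: 'a set. finite E \<longrightarrow>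
        (\<forall>U\<in>nbhds_neutral. \<exists>F. finite F \<and> F \<noteq> {} \<and>
          (\<forall>g\<in>E. real (matching_number F ((\<lambda>x. g + x) ` F) U) \<ge> \<theta> * real (card F))))) \<and>
    (amenable TYPE('a) \<longleftrightarrow>
      (\<exists>\<theta>\<in>{0<..<1::real}. \<forall>E :: 'a set. finite E \<longrightarrow>
        (\<forall>U\<in>nbhds_neutral. \<exists>F. finite F \<and> F \<noteq> {} \<and>
          (\<forall>g\<in>E. real (matching_number F ((\<lambda>x. g + x) ` F) U) \<ge> \<theta> * real (card F)))))"
  (is "(?am \<longleftrightarrow> (\<forall>\<theta>\<in>_. ?M \<theta>)) \<and> (_ \<longleftrightarrow> _)")
proof -
  have all: "\<forall>\<theta>\<in>{0<..<1}. ?M \<theta>" if ?am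
    using matchings_of_amenable[OF that] by simp
  have am: "?am" if "\<theta> \<in> {0<..<1}" "?M \<theta>" for \<theta>
    by (rule amenable_of_matchings[of \<theta>]) (use that in simp_all)
  have half: "(1 / 2 :: real) \<in> {0<..<1}" by simp
  have "?am" if "\<forall>\<theta>\<in>{0<..<1}. ?M \<theta>"
    by (rule am[OF half bspec[OF that half]])
  moreover have "\<exists>\<theta>\<in>{0<..<1}. ?M \<theta>" if ?am
    using bspec[OF all[OF that] half] half by (rule bexI)
  moreover have "?am" if "\<exists>\<theta>\<in>{0<..<1}. ?M \<theta>"
    using that am by (elim bexE)
  ultimately show ?thesis using all by (intro conjI iffI)
qed

end
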